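(* Let $a:\mathbb{C}\to\{-\infty\}\cup\mathbb{R}$ be an upper semicontinuous function. Then $\Omega_a:=\{(z,w)\in\mathbb{C}^2 : a(w)<\mathrm{Im}\,z\}$ is taut if and only if $a$ is a real valued, subharmonic, non-harmonic, continuous function.
   Context: Let $\Delta$ be the open unit disk in $\mathbb{C}$. A complex manifold $X$ is taut if every sequence of holomorphic maps $f_n:\Delta\to X$ admits a subsequence which either converges uniformly on compact subsets or is compactly divergent. *)

theory Defs
  imports "HOL-Complex_Analysis.Complex_Analysis"
begin

section \<open>Semicontinuous, harmonic and subharmonic functions\<close>

definition usc_on :: "'a::topological_space set \<Rightarrow> ('a \<Rightarrow> ereal) \<Rightarrow> bool"
  where "usc_on S u \<longleftrightarrow>
    (\<forall>x\<in>S. \<forall>t. u x < t \<longrightarrow> (\<forall>\<^sub>F y in at x within S. u y < t))"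

text \<open>
  Real harmonicity in the classical sense: of class C^2 with vanishing Laplacian.  The first
  two conditions say that the functions named \<open>ux\<close>, \<open>uy\<close>, \<open>uxx\<close>, ... are the partial derivatives
  with respect to the real and imaginary part.
\<close>

definition harmonic_on :: "complex set \<Rightarrow> (complex \<Rightarrow> real) \<Rightarrow> bool"
  where "harmonic_on S u \<longleftrightarrow> open S \<and>
    (\<exists>ux uy uxx uxy uyx uyy :: complex \<Rightarrow> real.
       (\<forall>p\<in>S. (u has_derivative (\<lambda>h. ux p * Re h + uy p * Im h)) (at p)) \<and>
       (\<forall>p\<in>S. (ux has_derivative (\<lambda>h. uxx p * Re h + uxy p * Im h)) (at p) \<and>
               (uy has_derivative (\<lambda>h. uyx p * Re h + uyy p * Im h)) (at p)) \<and>
       continuous_on S uxx \<and> continuous_on S uxy \<and> continuous_on S uyx \<and> continuous_on S uyy \<and>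
       (\<forall>p\<in>S. uxx p + uyy p = 0))"

text \<open>
  The mean value of an extended real function over a circle, as the integral of the positive part
  minus the integral of the negative part (\<open>e2ennreal\<close> sends negative numbers to 0).  If \<open>u\<close> is
  upper semicontinuous and less than \<open>\<infinity>\<close> on the circle, it is bounded above there, so only the
  second integral can be infinite and the mean is a well-defined element of \<open>[-\<infinity>, \<infinity>)\<close>.
\<close>

definition circle_mean :: "(complex \<Rightarrow> ereal) \<Rightarrow> complex \<Rightarrow> real \<Rightarrow> ereal"
  where "circle_mean u c r =
    (enn2ereal (\<integral>\<^sup>+t\<in>{0..2 * pi}. e2ennreal (u (c + of_real r * cis t)) \<partial>lborel) -
     enn2ereal (\<integral>\<^sup>+t\<in>{0..2 * pi}. e2ennreal (- u (c + of_real r * cis t)) \<partial>lborel))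
    / ereal (2 * pi)"

text \<open>The constant \<open>-\<infinity>\<close> counts as subharmonic here.\<close>

definition subharmonic_on :: "complex set \<Rightarrow> (complex \<Rightarrow> ereal) \<Rightarrow> bool"
  where "subharmonic_on S u \<longleftrightarrow> open S \<and> (\<forall>p\<in>S. u p \<noteq> \<infinity>) \<and> usc_on S u \<and>
    (\<forall>c r. 0 < r \<longrightarrow> cball c r \<subseteq> S \<longrightarrow> u c \<le> circle_mean u c r)"


section \<open>Taut domains in \<open>\<complex>\<^sup>2\<close>\<close>

definition hol_discs :: "(complex \<times> complex) set \<Rightarrow> (complex \<Rightarrow> complex \<times> complex) set"
  where "hol_discs X = {f. (\<lambda>\<zeta>. fst (f \<zeta>)) holomorphic_on ball 0 1 \<and>
                           (\<lambda>\<zeta>. snd (f \<zeta>)) holomorphic_on ball 0 1 \<and> f ` ball 0 1 \<subseteq> X}"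

text \<open>
  The limit has to be a map into \<open>X\<close>, not just into its closure.
\<close>

definition converges_in_discs ::
    "(complex \<times> complex) set \<Rightarrow> (nat \<Rightarrow> complex \<Rightarrow> complex \<times> complex) \<Rightarrow> bool"
  where "converges_in_discs X f \<longleftrightarrow>
    (\<exists>g\<in>hol_discs X. \<forall>K. compact K \<longrightarrow> K \<subseteq> ball 0 1 \<longrightarrow> uniform_limit K f g sequentially)"

definition compactly_divergent ::
    "(complex \<times> complex) set \<Rightarrow> (nat \<Rightarrow> complex \<Rightarrow> complex \<times> complex) \<Rightarrow> bool"
  where "compactly_divergent X f \<longleftrightarrow>
    (\<forall>K L. compact K \<longrightarrow> K \<subseteq> ball 0 1 \<longrightarrow> compact L \<longrightarrow> L \<subseteq> X \<longrightarrow>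
       (\<forall>\<^sub>F n in sequentially. f n ` K \<inter> L = {}))"

text \<open>Tautness of an open subset of \<open>\<complex>\<^sup>2\<close>, regarded as a complex manifold.\<close>

definition taut :: "(complex \<times> complex) set \<Rightarrow> bool"
  where "taut X \<longleftrightarrow> open X \<and>
    (\<forall>f :: nat \<Rightarrow> complex \<Rightarrow> complex \<times> complex. (\<forall>n. f n \<in> hol_discs X) \<longrightarrow>
       (\<exists>\<rho>. strict_mono \<rho> \<and>
          (converges_in_discs X (f \<circ> \<rho>) \<or> compactly_divergent X (f \<circ> \<rho>))))"

definition Omega :: "(complex \<Rightarrow> ereal) \<Rightarrow> (complex \<times> complex) set"
  where "Omega a = {(z, w). a w < ereal (Im z)}"

text \<open>Upper semicontinuity makes \<open>Omega a\<close> open, so that it is a complex manifold.\<close>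

lemma open_Omega:
  assumes "usc_on UNIV a"
  shows "open (Omega a)"
proof -
  have "\<forall>\<^sub>F y in nhds p. y \<in> Omega a" if p: "p \<in> Omega a" for p
  proof -
    obtain z w where zw: "p = (z, w)" by fastforce
    with p have "a w < ereal (Im z)" by (simp add: Omega_def)
    then obtain s where s: "a w < ereal s" "s < Im z"
      using ereal_dense2 by fastforce
    have "\<forall>\<^sub>F w' in at w. a w' < ereal s"
      using assms s(1) by (simp add: usc_on_def)
    then have 1: "\<forall>\<^sub>F w' in nhds w. a w' < ereal s"
      using s(1) by (simp add: eventually_nhds_conv_at)
    have "open {z. s < Im z}" by (rule open_halfspace_Im_gt)
    then have 2: "\<forall>\<^sub>F z' in nhds z. s < Im z'"
      using s(2) by (auto simp: eventually_nhds)
    have "\<forall>\<^sub>F y in nhds z \<times>\<^sub>F nhds w. s < Im (fst y) \<and> a (snd y) < ereal s"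
      using eventually_prodI[OF 2 1] by simp
    then show ?thesis
      unfolding zw nhds_prod
      by (rule eventually_mono) (auto simp: Omega_def intro: less_trans)
  qed
  then show ?thesis
    by (subst open_subopen) (fastforce simp: eventually_nhds)
qed

end

theory Submission
  imports Defs
begin

text \<open>
  Subharmonicity is used in the form of a strong maximum principle: a function that lies below a
  harmonic function near a point, with equality at the point, coincides with it nearby.  In this
  form it is invariant under composition with holomorphic maps (critical points are removable), and
  tautness yields it at once, because the discs \<open>(\<i> (H + 1/n), id)\<close> lie in \<open>Omega a\<close> when
  \<open>a \<le> Re H\<close>.

  For the converse, replace \<open>a\<close> on a disc of radius \<open>R\<close> by the harmonic function with the same
  boundary values.  As \<open>a\<close> is not harmonic, this increases \<open>a\<close> strictly for some \<open>R\<close>, and one can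
  subtract a small multiple of \<open>log+ (|w| / R)\<close> without losing subharmonicity.  This
  gives a subharmonic \<open>b\<close> with \<open>a - b \<ge> \<delta> log+ (|w| / R) - C\<close>.  For a disc \<open>(z, w)\<close> in
  \<open>Omega a\<close> the superharmonic function \<open>Im z - b(w)\<close> then dominates
  \<open>\<delta> log+ (|w| / R) - C\<close>, so that Harnack's inequality bounds \<open>w\<close>, and then \<open>z\<close>, locally in terms
  of the position of one point.  Montel's theorem provides the limit disc, which stays
  inside \<open>Omega a\<close> by the strong maximum principle for \<open>a(w)\<close>.
\<close>

section \<open>Subharmonic functions\<close>

text \<open>Non-harmonicity is what keeps discs bounded. If \<open>a = Re F\<close> with
  \<open>F\<close> entire, the shear \<open>(z, w) \<mapsto> (z - \<i> F(w), w)\<close> maps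
  \<open>Omega a\<close> onto a half plane times \<complex>, and the second factor carries discs of
  arbitrary size through a given point. Conversely, nothing is known about the growth of
  \<open>a\<close>, so a bound on \<open>w\<close> cannot come from the size of \<open>a\<close>; it
  comes from the gap between \<open>a\<close> and a second subharmonic function, which grows at
  least logarithmically however \<open>a\<close> behaves.

  The obstacle to Harnack's inequality is that \<open>log+ |w|\<close> is not harmonic along a disc.
  On a slightly smaller circle it is therefore replaced by the real part of an entire function with
  almost the same boundary values; this majorises \<open>log+ |w|\<close> inside and is still
  controlled at one point by the maximum principle. The same approximation of continuous boundary
  data does the work of the Poisson integral throughout. Circle means and the Laplacian enter only
  where the classical definitions are translated.\<close>

definition subh :: "complex set \<Rightarrow> (complex \<Rightarrow> real) \<Rightarrow> bool"
  where "subh S v \<longleftrightarrow>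
    (\<forall>p\<in>S. \<forall>H e. 0 < e \<longrightarrow> H holomorphic_on ball p e \<longrightarrow> (\<forall>x\<in>ball p e. v x \<le> Re (H x)) \<longrightarrow>
       v p = Re (H p) \<longrightarrow> (\<forall>\<^sub>F x in nhds p. v x = Re (H x)))"

lemma subhI:
  assumes "\<And>p H e. \<lbrakk>p \<in> S; 0 < e; H holomorphic_on ball p e; \<And>x. x \<in> ball p e \<Longrightarrow> v x \<le> Re (H x);
     v p = Re (H p)\<rbrakk> \<Longrightarrow> \<forall>\<^sub>F x in nhds p. v x = Re (H x)"
  shows "subh S v"
  using assms unfolding subh_def by blast

lemma subhD:
  assumes "subh S v" "p \<in> S" "0 < e" "H holomorphic_on ball p e"
    "\<And>x. x \<in> ball p e \<Longrightarrow> v x \<le> Re (H x)" "v p = Re (H p)"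
  shows "\<forall>\<^sub>F x in nhds p. v x = Re (H x)"
  using assms unfolding subh_def by blast

lemma subh_subset: "subh S v \<Longrightarrow> T \<subseteq> S \<Longrightarrow> subh T v"
  unfolding subh_def by blast

lemma subh_add_Re:
  assumes "subh S v" "open S" "F holomorphic_on S"
  shows "subh S (\<lambda>x. v x + Re (F x))"
proof (rule subhI)
  fix p H and e :: real
  assume p: "p \<in> S" and e: "0 < e" and H: "H holomorphic_on ball p e"
    and le: "\<And>x. x \<in> ball p e \<Longrightarrow> v x + Re (F x) \<le> Re (H x)" and eq: "v p + Re (F p) = Re (H p)"
  obtain d where d: "d > 0" "ball p d \<subseteq> S"
    using \<open>open S\<close> p openE by blast
  have "\<forall>\<^sub>F x in nhds p. v x = Re (H x - F x)"
  proof (rule subhD[OF assms(1) p])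
    show "0 < min d e" using d e by simp
    show "(\<lambda>x. H x - F x) holomorphic_on ball p (min d e)"
      by (intro holomorphic_intros holomorphic_on_subset[OF H] holomorphic_on_subset[OF assms(3)])
        (use d in auto)
    show "v x \<le> Re (H x - F x)" if "x \<in> ball p (min d e)" for x
      using le[of x] that by simp
  qed (use eq in simp)
  then show "\<forall>\<^sub>F x in nhds p. v x + Re (F x) = Re (H x)"
    by eventually_elim simp
qed

lemma subh_add_const: "subh S v \<Longrightarrow> open S \<Longrightarrow> subh S (\<lambda>x. v x + c)"
  using subh_add_Re[of S v "\<lambda>_. of_real c"] by simp

text \<open>Adding \<open>Re F\<close> at the end reduces this to the zero function, that is, to a
  nonnegative \<open>Re H\<close> vanishing at \<open>p\<close>. There \<open>exp (- H)\<close>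
  attains its maximal modulus 1 at \<open>p\<close> and is therefore constant.\<close>

lemma subh_Re:
  assumes "open S" "F holomorphic_on S"
  shows "subh S (\<lambda>x. Re (F x))"
proof -
  have "subh S (\<lambda>x. 0)"
  proof (rule subhI)
    fix p H and e :: real
    assume p: "p \<in> S" and e: "0 < e" and H: "H holomorphic_on ball p e"
      and le: "\<And>x. x \<in> ball p e \<Longrightarrow> 0 \<le> Re (H x)" and eq: "0 = Re (H p)"
    have "(\<lambda>x. exp (- H x)) constant_on ball p e"
    proof (rule maximum_modulus_principle)
      show "(\<lambda>x. exp (- H x)) holomorphic_on ball p e"
        by (intro holomorphic_intros H)
      show "p \<in> ball p e" using e by simp
      show "cmod (exp (- H z)) \<le> cmod (exp (- H p))" if "z \<in> ball p e" for z
        using le[OF that] eq by simp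
    qed auto
    then obtain k where k: "\<And>x. x \<in> ball p e \<Longrightarrow> exp (- H x) = k"
      unfolding constant_on_def by blast
    have "0 = Re (H x)" if "x \<in> ball p e" for x
    proof -
      have "exp (- H x) = exp (- H p)" using k that e by simp
      then have "cmod (exp (- H x)) = cmod (exp (- H p))" by simp
      then show ?thesis using eq by simp
    qed
    then show "\<forall>\<^sub>F x in nhds p. 0 = Re (H x)"
      using eventually_nhds_in_open[of "ball p e" p] e by (auto elim!: eventually_mono)
  qed
  from subh_add_Re[OF this assms] show ?thesis by simp
qed

text \<open>A positive maximum cannot lie on the frontier. The set \<open>E\<close> of maximum
  points is closed, and contact with the constant \<open>m\<close> makes it open in the plane. A
  nonempty clopen set is the whole plane, contrary to boundedness; components of \<open>S\<close>
  never have to be considered.\<close>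

theorem subh_max_principle:
  assumes "open S" "bounded S" "continuous_on (closure S) v" "subh S v"
    and fr: "\<And>x. x \<in> frontier S \<Longrightarrow> v x \<le> 0" and x: "x \<in> closure S"
  shows "v x \<le> 0"
proof (rule ccontr)
  assume neg: "\<not> v x \<le> 0"
  have comp: "compact (closure S)" and ne: "closure S \<noteq> {}"
    using assms(2) x by auto
  obtain p where p: "p \<in> closure S" "\<And>y. y \<in> closure S \<Longrightarrow> v y \<le> v p"
    using continuous_attains_sup[OF comp ne assms(3)] by blast
  define m where "m = v p"
  have m: "m > 0" using p(2)[OF x] neg unfolding m_def by linarith
  define E where "E = {y \<in> closure S. v y = m}"
  have ES: "E \<subseteq> S"
  proof
    fix y assume y: "y \<in> E"
    then have "y \<notin> frontier S" using fr[of y] m by (auto simp: E_def)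
    then show "y \<in> S" using y by (simp add: E_def frontier_def interior_open[OF \<open>open S\<close>])
  qed
  have "closed E"
    unfolding E_def using continuous_closed_preimage_constant[OF assms(3)] by simp
  moreover have "open E"
  proof (subst open_subopen, intro ballI)
    fix y assume y: "y \<in> E"
    then have yS: "y \<in> S" using ES by blast
    then obtain d where d: "d > 0" "ball y d \<subseteq> S" using \<open>open S\<close> openE by blast
    have "\<forall>\<^sub>F x in nhds y. v x = Re (of_real m)"
    proof (rule subhD[OF assms(4) yS d(1)])
      show "v x \<le> Re (of_real m)" if "x \<in> ball y d" for x
        using p(2)[of x] d that closure_subset[of S] unfolding m_def by (auto simp: subset_iff)
      show "v y = Re (of_real m)" using y by (simp add: E_def)
    qed auto
    moreover have "\<forall>\<^sub>F x in nhds y. x \<in> S"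
      using yS \<open>open S\<close> by (rule eventually_nhds_in_open[rotated])
    ultimately have "\<forall>\<^sub>F x in nhds y. x \<in> E"
      by eventually_elim (use closure_subset in \<open>auto simp: E_def\<close>)
    then show "\<exists>T. open T \<and> y \<in> T \<and> T \<subseteq> E"
      unfolding eventually_nhds by blast
  qed
  moreover have "p \<in> E" using p by (simp add: E_def m_def)
  ultimately have "E = UNIV"
    using clopen by blast
  then show False
    using ES assms(2) bounded_subset not_bounded_UNIV by blast
qed

lemma subh_le_Re_cball:
  assumes r: "0 < r" and "continuous_on (cball c r) v" "subh (ball c r) v"
    and "continuous_on (cball c r) H" "H holomorphic_on ball c r"
    and "\<And>x. x \<in> sphere c r \<Longrightarrow> v x \<le> Re (H x)" and x: "x \<in> cball c r"
  shows "v x \<le> Re (H x)"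
proof -
  have "v x + Re (- H x) \<le> 0"
  proof (rule subh_max_principle[where S = "ball c r" and v = "\<lambda>x. v x + Re (- H x)"])
    show "subh (ball c r) (\<lambda>x. v x + Re (- H x))"
      by (rule subh_add_Re) (auto intro!: assms holomorphic_intros)
    show "continuous_on (closure (ball c r)) (\<lambda>x. v x + Re (- H x))"
      using r assms by (auto intro!: continuous_intros)
  qed (use r x assms(6) in \<open>auto simp: frontier_ball\<close>)
  then show ?thesis by simp
qed

lemma subh_strong_max_principle:
  assumes "open S" "connected S" "continuous_on S v" "subh S v" "H holomorphic_on S"
    and le: "\<And>x. x \<in> S \<Longrightarrow> v x \<le> Re (H x)" and p: "p \<in> S" "v p = Re (H p)" and "x \<in> S"
  shows "v x = Re (H x)"
proof -
  define E where "E = {x \<in> S. v x - Re (H x) = 0}"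
  have "openin (top_of_set S) E"
  proof -
    have "open E"
    proof (subst open_subopen, intro ballI)
      fix y assume y: "y \<in> E"
      then have yS: "y \<in> S" by (simp add: E_def)
      then obtain t where t: "t > 0" "ball y t \<subseteq> S" using \<open>open S\<close> openE by blast
      have "\<forall>\<^sub>F z in nhds y. v z = Re (H z)"
      proof (rule subhD[OF assms(4) yS t(1)])
        show "H holomorphic_on ball y t" using assms(5) t(2) by (rule holomorphic_on_subset)
        show "v z \<le> Re (H z)" if "z \<in> ball y t" for z using le t(2) that by blast
        show "v y = Re (H y)" using y by (simp add: E_def)
      qed
      moreover have "\<forall>\<^sub>F z in nhds y. z \<in> S"
        using yS \<open>open S\<close> by (rule eventually_nhds_in_open[rotated])
      ultimately have "\<forall>\<^sub>F z in nhds y. z \<in> E"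
        by eventually_elim (auto simp: E_def)
      then show "\<exists>T. open T \<and> y \<in> T \<and> T \<subseteq> E" unfolding eventually_nhds by blast
    qed
    then show ?thesis using \<open>open S\<close> by (auto simp: openin_open_eq E_def)
  qed
  moreover have "closedin (top_of_set S) E"
    unfolding E_def
    by (intro continuous_closedin_preimage_constant continuous_intros assms
        holomorphic_on_imp_continuous_on)
  ultimately have "E = {} \<or> E = S" using \<open>connected S\<close> unfolding connected_clopen by blast
  moreover have "p \<in> E" using p by (simp add: E_def)
  ultimately have "x \<in> E" using \<open>x \<in> S\<close> by (metis empty_iff)
  then show ?thesis by (simp add: E_def)
qed

text \<open>On a disc avoiding \<open>p\<close> the function \<open>x - p\<close> has a holomorphic
  logarithm, so the added term is locally harmonic and both signs of \<open>\<kappa>\<close> are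
  allowed: a positive one gives a barrier at a puncture, a negative one the logarithmic
  minorant.\<close>

lemma subh_add_ln:
  assumes S: "open S" "subh S v" "p \<notin> S" and s: "0 < s"
  shows "subh S (\<lambda>x. v x + \<kappa> * ln (dist p x / s))"
proof (rule subhI)
  fix y K and t :: real
  assume y: "y \<in> S" and t: "0 < t" and K: "K holomorphic_on ball y t"
    and le: "\<And>x. x \<in> ball y t \<Longrightarrow> v x + \<kappa> * ln (dist p x / s) \<le> Re (K x)"
    and eq: "v y + \<kappa> * ln (dist p y / s) = Re (K y)"
  obtain t' where t': "t' > 0" "ball y t' \<subseteq> S" using y S(1) openE by blast
  define u where "u = min t t'"
  have u: "u > 0" "ball y u \<subseteq> ball y t" using t t' by (auto simp: u_def)
  have nz: "x - p \<noteq> 0" if "x \<in> ball y u" for x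
    using that t'(2) S(3) by (auto simp: u_def)
  have "\<exists>L. L holomorphic_on ball y u \<and> (\<forall>x\<in>ball y u. x - p = exp (L x))"
    by (rule contractible_imp_holomorphic_log[of "\<lambda>x. x - p" "ball y u"])
      (use nz in \<open>auto intro!: holomorphic_intros convex_imp_contractible\<close>)
  then obtain L where L: "L holomorphic_on ball y u" "\<And>x. x \<in> ball y u \<Longrightarrow> x - p = exp (L x)"
    by blast
  have ReL: "ln (dist p x / s) = Re (L x - of_real (ln s))" if "x \<in> ball y u" for x
  proof -
    have "dist p x = cmod (exp (L x))" using L(2)[OF that] by (metis dist_norm norm_minus_commute)
    then show ?thesis using s by (simp add: ln_div)
  qed
  have "\<forall>\<^sub>F x in nhds y. v x = Re (K x - of_real \<kappa> * (L x - of_real (ln s)))"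
  proof (rule subhD[OF S(2) y u(1)])
    show "(\<lambda>x. K x - of_real \<kappa> * (L x - of_real (ln s))) holomorphic_on ball y u"
      by (intro holomorphic_intros L holomorphic_on_subset[OF K u(2)])
    show "v x \<le> Re (K x - of_real \<kappa> * (L x - of_real (ln s)))" if "x \<in> ball y u" for x
      using le[of x] ReL[OF that] that u(2) by force
    show "v y = Re (K y - of_real \<kappa> * (L y - of_real (ln s)))"
      using eq ReL[of y] u by simp
  qed
  moreover have "\<forall>\<^sub>F x in nhds y. x \<in> ball y u"
    using u by (intro eventually_nhds_in_open) auto
  ultimately show "\<forall>\<^sub>F x in nhds y. v x + \<kappa> * ln (dist p x / s) = Re (K x)"
    by eventually_elim (use ReL in simp)
qed

lemma subh_cong:
  assumes "open S" "subh S v" and eq: "\<And>x. x \<in> S \<Longrightarrow> u x = v x"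
  shows "subh S u"
proof (rule subhI)
  fix p H and e :: real
  assume p: "p \<in> S" and e: "0 < e" and H: "H holomorphic_on ball p e"
    and le: "\<And>x. x \<in> ball p e \<Longrightarrow> u x \<le> Re (H x)" and pe: "u p = Re (H p)"
  obtain d where d: "d > 0" "ball p d \<subseteq> S"
    using \<open>open S\<close> p openE by blast
  have "\<forall>\<^sub>F x in nhds p. v x = Re (H x)"
  proof (rule subhD[OF assms(2) p])
    show "0 < min d e" using d e by simp
    show "H holomorphic_on ball p (min d e)" by (rule holomorphic_on_subset[OF H]) auto
    show "v x \<le> Re (H x)" if "x \<in> ball p (min d e)" for x
      using le[of x] eq[of x] d that by (auto simp: subset_iff)
  qed (use eq p pe in simp)
  moreover have "\<forall>\<^sub>F x in nhds p. x \<in> S"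
    using p \<open>open S\<close> by (rule eventually_nhds_in_open[rotated])
  ultimately show "\<forall>\<^sub>F x in nhds p. u x = Re (H x)"
    by eventually_elim (use eq in simp)
qed

text \<open>Only contact at \<open>p\<close> itself is new. If \<open>V\<close>, the difference to
  the test function, were negative on the whole punctured disc, a logarithmic barrier would carry
  the bound \<open>- \<eta>\<close> from a circle up to \<open>p\<close>, against continuity and
  \<open>V p = 0\<close>. So \<open>V\<close> vanishes somewhere off \<open>p\<close>, and the
  strong maximum principle on the connected punctured disc applies.\<close>

lemma subh_removable:
  assumes "open S" "continuous_on S v" and sub: "subh (S - {p}) v"
  shows "subh S v"
proof (rule subhI)
  fix q H and e :: real
  assume q: "q \<in> S" and e: "0 < e" and H: "H holomorphic_on ball q e"
    and le: "\<And>x. x \<in> ball q e \<Longrightarrow> v x \<le> Re (H x)" and eq: "v q = Re (H q)"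
  show "\<forall>\<^sub>F x in nhds q. v x = Re (H x)"
  proof (cases "q = p")
    case False
    then show ?thesis using subhD[OF sub _ e H le eq] q by blast
  next
    case qp: True
    obtain d where d: "d > 0" "ball p d \<subseteq> S" using \<open>open S\<close> openE q qp by blast
    define \<rho> where "\<rho> = min d e / 2"
    have \<rho>: "\<rho> > 0" "cball p \<rho> \<subseteq> ball p d" "cball p \<rho> \<subseteq> ball p e"
      using d e by (auto simp: \<rho>_def)
    define V where "V x = v x + Re (- H x)" for x
    have V: "V x \<le> 0" if "x \<in> cball p \<rho>" for x
      using le[of x] \<rho>(3) that qp unfolding V_def by auto
    have Vp: "V p = 0" using eq qp by (simp add: V_def)
    have cV: "continuous_on (cball p \<rho>) V"
      unfolding V_def using \<rho> d
      by (intro continuous_intros continuous_on_subset[OF assms(2)]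
          continuous_on_subset[OF holomorphic_on_imp_continuous_on[OF H]]) (auto simp: qp)
    have sV: "subh (ball p \<rho> - {p}) V"
      unfolding V_def
      by (rule subh_add_Re[OF subh_subset[OF sub]])
        (use \<rho>(2,3) d qp in \<open>auto intro!: holomorphic_intros holomorphic_on_subset[OF H] simp: subset_iff\<close>)
    have "\<exists>y \<in> ball p \<rho> - {p}. V y = 0"
    proof (rule ccontr)
      assume no: "\<not> ?thesis"
      define s where "s = \<rho> / 2"
      have s: "0 < s" "s < \<rho>" using \<rho> by (auto simp: s_def)
      have "continuous_on (sphere p s) V"
        using s by (intro continuous_on_subset[OF cV]) auto
      moreover have "compact (sphere p s)" "sphere p s \<noteq> {}" using s by auto
      ultimately obtain z where z: "z \<in> sphere p s" "\<And>y. y \<in> sphere p s \<Longrightarrow> V y \<le> V z"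
        using continuous_attains_sup[of "sphere p s" V] by blast
      define \<eta> where "\<eta> = - V z"
      have "V z \<noteq> 0" using no z s by (auto simp: dist_norm)
      then have \<eta>: "\<eta> > 0" using V[of z] z s unfolding \<eta>_def by force
      have bound: "V x \<le> - \<eta>" if x: "x \<in> ball p s - {p}" for x
      proof (rule field_le_epsilon)
        fix \<epsilon> :: real assume \<epsilon>: "\<epsilon> > 0"
        \<comment> \<open>With this weight the barrier \<open>\<kappa> * ln (dist p y / s)\<close>
          equals \<open>- \<epsilon>\<close> at \<open>y = x\<close>.\<close>
        define \<kappa> where "\<kappa> = \<epsilon> / ln (s / dist p x)"
        have dx: "0 < dist p x" "dist p x < s" using x by auto
        have lnpos: "ln (s / dist p x) > 0" using dx by (intro ln_gt_zero) (simp add: divide_simps)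
        have \<kappa>: "\<kappa> > 0" using \<epsilon> lnpos by (simp add: \<kappa>_def)
        \<comment> \<open>The inner radius is so small that the barrier is at most
          \<open>- \<eta>\<close> there; on that circle only \<open>V \<le> 0\<close> is
          known.\<close>
        define \<sigma> where "\<sigma> = min (dist p x / 2) (s * exp (- \<eta> / \<kappa>))"
        have \<sigma>: "\<sigma> > 0" "\<sigma> < dist p x" using dx s by (auto simp: \<sigma>_def min_less_iff_disj)
        define A where "A = ball p s - cball p \<sigma>"
        define W where "W y = V y + \<kappa> * ln (dist p y / s) + \<eta>" for y
        have clA: "closure A \<subseteq> cball p s - ball p \<sigma>"
          unfolding A_def by (rule closure_minimal) (auto simp: closed_Diff)
        have "W x \<le> 0"
        proof (rule subh_max_principle[of A])
          show oA: "open A" unfolding A_def by (simp add: open_Diff)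
          show "bounded A" unfolding A_def by (rule bounded_subset[of "ball p s"]) auto
          have "continuous_on (cball p s - ball p \<sigma>) W"
            unfolding W_def using s \<sigma>
            by (intro continuous_intros continuous_on_subset[OF cV]) auto
          then show "continuous_on (closure A) W" using clA continuous_on_subset by blast
          show "x \<in> closure A" using x dx \<sigma> closure_subset[of A] unfolding A_def by auto
          show "W y \<le> 0" if y: "y \<in> frontier A" for y
          proof -
            have y': "y \<in> cball p s - ball p \<sigma>" "y \<notin> A"
              using y clA oA by (auto simp: frontier_def interior_open)
            then consider "dist p y = s" | "dist p y = \<sigma>" unfolding A_def by force
            then show ?thesis
            proof cases
              case 1
              then show ?thesis using z(2)[of y] s by (simp add: W_def \<eta>_def)
            next
              case 2
              have "\<sigma> / s \<le> exp (- \<eta> / \<kappa>)" using s by (simp add: \<sigma>_def divide_simps mult.commute)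
              then have "ln (\<sigma> / s) \<le> - \<eta> / \<kappa>"
                using ln_le_cancel_iff[of "\<sigma> / s" "exp (- \<eta> / \<kappa>)"] s \<sigma> by (simp del: ln_le_cancel_iff)
              then have "\<kappa> * ln (\<sigma> / s) + \<eta> \<le> 0" using \<kappa> by (simp add: field_simps)
              moreover have "V y \<le> 0" using V[of y] y' s by auto
              ultimately show ?thesis using 2 by (simp add: W_def)
            qed
          qed
          have "subh A (\<lambda>y. V y + \<kappa> * ln (dist p y / s))"
          proof (rule subh_add_ln[OF oA _ _ s(1)])
            show "subh A V" by (rule subh_subset[OF sV]) (use s \<sigma> in \<open>auto simp: A_def\<close>)
            show "p \<notin> A" using \<sigma> by (simp add: A_def)
          qed
          then show "subh A W"
            unfolding W_def by (rule subh_add_const[OF _ oA])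
        qed
        then have "V x \<le> \<kappa> * ln (s / dist p x) - \<eta>"
          using dx s by (simp add: W_def ln_div algebra_simps)
        then show "V x \<le> - \<eta> + \<epsilon>" using lnpos by (simp add: \<kappa>_def)
      qed
      have "continuous (at p) V"
        using continuous_on_interior[OF cV, of p] \<rho> by simp
      then have "(V \<longlongrightarrow> V p) (at p)" by (simp add: continuous_at)
      moreover have "\<forall>\<^sub>F x in at p. V x \<le> - \<eta>"
        unfolding eventually_at using s bound
        by (intro exI[of _ s]) (auto simp: dist_commute)
      ultimately have "V p \<le> - \<eta>"
        by (intro tendsto_upperbound[of V "V p" "at p"]) auto
      then show False using Vp \<eta> by simp
    qed
    then obtain y where y: "y \<in> ball p \<rho> - {p}" "V y = 0" by blast
    have "V x = 0" if "x \<in> ball p \<rho>" for x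
    proof (cases "x = p")
      case False
      have "V x = Re 0"
      proof (rule subh_strong_max_principle[OF _ _ _ sV, where H = "\<lambda>_. 0"])
        show "connected (ball p \<rho> - {p})" by (rule connected_punctured_ball) simp
        show "continuous_on (ball p \<rho> - {p}) V" by (rule continuous_on_subset[OF cV]) auto
      qed (use y V that False in \<open>auto simp: open_Diff\<close>)
      then show ?thesis by simp
    qed (use Vp in simp)
    then show ?thesis
      using eventually_nhds_in_open[of "ball p \<rho>" p] \<rho>(1) qp
      by (auto elim!: eventually_mono simp: V_def)
  qed
qed

section \<open>The Dirichlet problem on a disc\<close>

text \<open>On the unit circle \<open>x * cnj x = 1\<close>, so every mixed monomial collapses to a
  pure power of \<open>x\<close> or of \<open>cnj x\<close>.\<close>

lemma poly_mult_cnj_on_circle: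
  fixes p q :: "complex poly"
  shows "\<exists>A B. \<forall>x. cmod x = 1 \<longrightarrow> poly p x * cnj (poly q x) = poly A x + cnj (poly B x)"
proof (induction p)
  case 0
  show ?case by (rule exI[of _ 0], rule exI[of _ 0]) simp
next
  case (pCons a p)
  then obtain A B where AB: "\<And>x. cmod x = 1 \<Longrightarrow> poly p x * cnj (poly q x) = poly A x + cnj (poly B x)"
    by blast
  \<comment> \<open>Multiplication by \<open>x\<close> lowers the degree of the conjugated
    polynomial: \<open>x * cnj (b + x * B' x)\<close> is
    \<open>x * cnj b + cnj (B' x)\<close>.\<close>
  obtain b B' where B: "B = pCons b B'" by (cases B)
  show ?case
  proof (intro exI allI impI)
    fix x :: complex assume x: "cmod x = 1"
    then have xx: "x * cnj x = 1" by (simp add: complex_norm_square[symmetric])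
    have "poly (pCons a p) x * cnj (poly q x) = a * cnj (poly q x) + x * (poly p x * cnj (poly q x))"
      by (simp add: algebra_simps)
    also have "\<dots> = a * cnj (poly q x) + x * poly A x + x * cnj b + (x * cnj x) * cnj (poly B' x)"
      by (simp add: AB[OF x] B algebra_simps)
    also have "\<dots> = poly (pCons 0 (A + [:cnj b:])) x + cnj (poly (smult (cnj a) q + B') x)"
      by (simp add: xx algebra_simps)
    finally show "poly (pCons a p) x * cnj (poly q x) =
        poly (pCons 0 (A + [:cnj b:])) x + cnj (poly (smult (cnj a) q + B') x)" .
  qed
qed

text \<open>Makes the real parts of polynomials an algebra on the unit circle, as Stone-Weierstrass
  demands, by way of \<open>2 Re P Re Q = Re (P Q) + Re (P cnj Q)\<close>.\<close>

lemma Re_poly_mult_on_circle: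
  fixes p q :: "complex poly"
  shows "\<exists>h. \<forall>x. cmod x = 1 \<longrightarrow> Re (poly p x) * Re (poly q x) = Re (poly h x)"
proof -
  obtain A B where AB: "\<And>x. cmod x = 1 \<Longrightarrow> poly p x * cnj (poly q x) = poly A x + cnj (poly B x)"
    using poly_mult_cnj_on_circle by blast
  show ?thesis
  proof (intro exI allI impI)
    fix x :: complex assume x: "cmod x = 1"
    have "2 * (Re (poly p x) * Re (poly q x)) =
        Re (poly p x * poly q x) + Re (poly p x * cnj (poly q x))"
      by simp
    also have "\<dots> = Re (poly p x * poly q x) + Re (poly A x) + Re (poly B x)"
      by (simp add: AB[OF x] del: times_complex.sel)
    finally show "Re (poly p x) * Re (poly q x) = Re (poly (smult (1/2) (p * q + A + B)) x)"
      by (simp add: field_simps)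
  qed
qed

text \<open>Stone-Weierstrass for real parts of polynomials on the unit circle, transported by an
  affine map. As the approximants are entire, Cauchy's formula and the maximum principle apply to
  them up to the boundary.\<close>

lemma Re_entire_approx_on_sphere:
  fixes v :: "complex \<Rightarrow> real"
  assumes r: "0 < r" and v: "continuous_on (sphere c r) v" and e: "0 < e"
  obtains H where "H holomorphic_on UNIV" "\<And>x. x \<in> sphere c r \<Longrightarrow> \<bar>v x - Re (H x)\<bar> < e"
proof -
  define R where "R = {f :: complex \<Rightarrow> real. \<exists>p. \<forall>x. cmod x = 1 \<longrightarrow> f x = Re (poly p x)}"
  interpret function_ring_on R "sphere (0::complex) 1"
  proof
    show "compact (sphere (0::complex) 1)" by simp
    show "continuous_on (sphere 0 1) f" if fR: "f \<in> R" for f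
    proof -
      obtain p where "\<And>x. cmod x = 1 \<Longrightarrow> f x = Re (poly p x)" using fR by (auto simp: R_def)
      then have "continuous_on (sphere 0 1) f \<longleftrightarrow> continuous_on (sphere 0 1) (\<lambda>x. Re (poly p x))"
        by (intro continuous_on_cong) auto
      then show ?thesis by (auto intro!: continuous_intros)
    qed
    show "(\<lambda>x. f x + g x) \<in> R" if fg: "f \<in> R" "g \<in> R" for f g
    proof -
      obtain p q where "\<And>x. cmod x = 1 \<Longrightarrow> f x = Re (poly p x)" "\<And>x. cmod x = 1 \<Longrightarrow> g x = Re (poly q x)"
        using fg by (auto simp: R_def)
      then show ?thesis unfolding R_def by (auto intro!: exI[of _ "p + q"])
    qed
    show "(\<lambda>x. f x * g x) \<in> R" if fg: "f \<in> R" "g \<in> R" for f g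
    proof -
      obtain p q where "\<And>x. cmod x = 1 \<Longrightarrow> f x = Re (poly p x)" "\<And>x. cmod x = 1 \<Longrightarrow> g x = Re (poly q x)"
        using fg by (auto simp: R_def)
      then show ?thesis unfolding R_def using Re_poly_mult_on_circle[of p q] by auto
    qed
    show "(\<lambda>_. k) \<in> R" for k
      unfolding R_def by (auto intro!: exI[of _ "[:of_real k:]"])
    fix x y :: complex
    assume xy: "x \<noteq> y"
    have "(\<lambda>x. Re x) \<in> R" unfolding R_def by (auto intro!: exI[of _ "[:0, 1:]"])
    moreover have "(\<lambda>x. Im x) \<in> R" unfolding R_def by (auto intro!: exI[of _ "[:0, - \<i>:]"])
    moreover have "Re x \<noteq> Re y \<or> Im x \<noteq> Im y" using xy complex_eqI by blast
    ultimately show "\<exists>f\<in>R. f x \<noteq> f y" by blast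
  qed
  have "continuous_on (sphere 0 1) (\<lambda>x. v (c + of_real r * x))"
    using r by (intro continuous_on_compose2[OF v]) (auto intro!: continuous_intros simp: dist_norm norm_mult)
  then obtain g where g: "g \<in> R" "\<And>x. x \<in> sphere 0 1 \<Longrightarrow> \<bar>v (c + of_real r * x) - g x\<bar> < e"
    using Stone_Weierstrass_basic e by blast
  then obtain p where p: "\<And>x. cmod x = 1 \<Longrightarrow> g x = Re (poly p x)" by (auto simp: R_def)
  show ?thesis
  proof (rule that)
    show "(\<lambda>x. poly p ((x - c) / of_real r)) holomorphic_on UNIV"
      using r by (intro holomorphic_intros) auto
    show "\<bar>v x - Re (poly p ((x - c) / of_real r))\<bar> < e" if "x \<in> sphere c r" for x
    proof -
      have n: "cmod ((x - c) / of_real r) = 1"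
        using that r by (simp add: norm_divide dist_norm norm_minus_commute)
      have "c + of_real r * ((x - c) / of_real r) = x" using r by simp
      then show ?thesis using g(2)[of "(x - c) / of_real r"] p[OF n] n by simp
    qed
  qed
qed

text \<open>By the maximum principle the real parts of boundary approximants converge uniformly on
  the closed disc. Nothing normalises their imaginary parts, so Montel's theorem is applied to
  \<open>exp (H n)\<close>, where an imaginary constant is only a rotation. The limit
  \<open>G\<close> has modulus \<open>exp (u x)\<close>, hence no zeros, and its logarithm is
  \<open>F\<close>.\<close>

theorem Dirichlet_disc:
  fixes v :: "complex \<Rightarrow> real"
  assumes r: "0 < r" and v: "continuous_on (sphere c r) v"
  obtains u F where "continuous_on (cball c r) u" "\<And>x. x \<in> sphere c r \<Longrightarrow> u x = v x"
    "F holomorphic_on ball c r" "\<And>x. x \<in> ball c r \<Longrightarrow> u x = Re (F x)"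
proof -
  have "\<exists>H. H holomorphic_on UNIV \<and> (\<forall>x\<in>sphere c r. \<bar>v x - Re (H x)\<bar> < inverse (real (Suc n)))" for n
    by (rule Re_entire_approx_on_sphere[OF r v, of "inverse (real (Suc n))"]) auto
  then obtain H where H: "\<And>n. H n holomorphic_on UNIV"
    "\<And>n x. x \<in> sphere c r \<Longrightarrow> \<bar>v x - Re (H n x)\<bar> < inverse (real (Suc n))"
    by metis
  have Hon: "H n holomorphic_on S" for n S using H(1) holomorphic_on_subset by blast
  have Hc: "continuous_on S (H n)" for n S using Hon holomorphic_on_imp_continuous_on by blast
  have le: "Re (H m x) \<le> Re (H n x) + (inverse (real (Suc m)) + inverse (real (Suc n)))"
    if "x \<in> cball c r" for m n x
  proof -
    have "Re (H m x) \<le> Re (H n x + of_real (inverse (real (Suc m)) + inverse (real (Suc n))))"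
    proof (rule subh_le_Re_cball[OF r _ _ _ _ _ that, where v = "\<lambda>x. Re (H m x)" and
          H = "\<lambda>x. H n x + of_real (inverse (real (Suc m)) + inverse (real (Suc n)))"])
      show "subh (ball c r) (\<lambda>x. Re (H m x))" by (rule subh_Re) (auto intro: Hon)
      show "Re (H m x) \<le> Re (H n x + of_real (inverse (real (Suc m)) + inverse (real (Suc n))))"
        if "x \<in> sphere c r" for x
        using H(2)[OF that, of m] H(2)[OF that, of n]
        unfolding plus_complex.sel Re_complex_of_real abs_less_iff by linarith
    qed (auto intro!: continuous_intros holomorphic_intros Hon Hc)
    then show ?thesis unfolding plus_complex.sel Re_complex_of_real .
  qed
  have "uniformly_convergent_on (cball c r) (\<lambda>n x. Re (H n x))"
  proof (rule Cauchy_uniformly_convergent, unfold uniformly_Cauchy_on_def, intro allI impI)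
    fix e :: real assume e: "e > 0"
    obtain N where N: "inverse (real (Suc N)) < e / 2" using e reals_Archimedean[of "e/2"] by auto
    show "\<exists>M. \<forall>x\<in>cball c r. \<forall>m\<ge>M. \<forall>n\<ge>M. dist (Re (H m x)) (Re (H n x)) < e"
    proof (intro exI ballI allI impI)
      fix x m n assume x: "x \<in> cball c r" and "N \<le> m" "N \<le> n"
      then have "inverse (real (Suc m)) \<le> inverse (real (Suc N))" "inverse (real (Suc n)) \<le> inverse (real (Suc N))"
        by (auto intro!: le_imp_inverse_le)
      then show "dist (Re (H m x)) (Re (H n x)) < e"
        using le[OF x, of m n] le[OF x, of n m] N unfolding dist_real_def by linarith
    qed
  qed
  then obtain u where u: "uniform_limit (cball c r) (\<lambda>n x. Re (H n x)) u sequentially"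
    unfolding uniformly_convergent_on_def by blast
  have ulim: "(\<lambda>n. Re (H n x)) \<longlonglongrightarrow> u x" if "x \<in> cball c r" for x
    using tendsto_uniform_limitI[OF u that] .
  have cu: "continuous_on (cball c r) u"
    by (rule uniform_limit_theorem[OF _ u]) (auto intro!: always_eventually continuous_intros Hc)
  have uv: "u x = v x" if "x \<in> sphere c r" for x
  proof (rule LIMSEQ_unique)
    show "(\<lambda>n. Re (H n x)) \<longlonglongrightarrow> u x" using that by (intro ulim) auto
    have "(\<lambda>n. v x - Re (H n x)) \<longlonglongrightarrow> 0"
      by (rule Lim_null_comparison[OF _ LIMSEQ_inverse_real_of_nat])
        (use H(2)[OF that] in \<open>auto intro!: always_eventually less_imp_le simp del: of_nat_Suc\<close>)
    then show "(\<lambda>n. Re (H n x)) \<longlonglongrightarrow> v x"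
      using tendsto_diff[OF tendsto_const[of "v x"], of "\<lambda>n. v x - Re (H n x)" 0] by simp
  qed
  have "bounded (H 0 ` cball c r)"
    by (intro compact_imp_bounded compact_continuous_image[OF Hc]) simp
  then obtain M where M: "\<And>x. x \<in> cball c r \<Longrightarrow> cmod (H 0 x) \<le> M"
    unfolding bounded_iff by (metis imageI)
  \<comment> \<open>Comparison with \<open>H 0\<close>; the summand 2 absorbs the tolerances of
    \<open>H n\<close> and \<open>H 0\<close>, each at most 1.\<close>
  have bd: "cmod (exp (H n x)) \<le> exp (M + 2)" if "x \<in> ball c r" for n x
  proof -
    have "inverse (real (Suc n)) \<le> 1" by (simp add: inverse_le_1_iff)
    moreover have "inverse (real (Suc 0)) = 1" by simp
    moreover have "x \<in> cball c r" using that by simp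
    ultimately have "Re (H n x) \<le> M + 2"
      using le[of x n 0] M[of x] complex_Re_le_cmod[of "H 0 x"] by linarith
    then show ?thesis by simp
  qed
  obtain G \<rho> where G: "G holomorphic_on ball c r" "strict_mono (\<rho> :: nat \<Rightarrow> nat)"
    "\<And>x. x \<in> ball c r \<Longrightarrow> ((\<lambda>n. exp (H (\<rho> n) x)) \<longlongrightarrow> G x) sequentially"
  proof (rule Montel[of "ball c r" "range (\<lambda>n x. exp (H n x))" "\<lambda>n x. exp (H n x)"])
    show "\<exists>B. \<forall>h\<in>range (\<lambda>n x. exp (H n x)). \<forall>z\<in>K. cmod (h z) \<le> B" if "K \<subseteq> ball c r" for K
      using bd that by blast
  qed (auto intro!: holomorphic_intros Hon)
  have modG: "cmod (G x) = exp (u x)" if "x \<in> ball c r" for x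
  proof (rule LIMSEQ_unique)
    show "(\<lambda>n. cmod (exp (H (\<rho> n) x))) \<longlonglongrightarrow> cmod (G x)"
      by (intro tendsto_norm G that)
    have "(\<lambda>n. Re (H (\<rho> n) x)) \<longlonglongrightarrow> u x"
      using LIMSEQ_subseq_LIMSEQ[OF ulim G(2), of x] that by (simp add: o_def)
    then show "(\<lambda>n. cmod (exp (H (\<rho> n) x))) \<longlonglongrightarrow> exp (u x)"
      by (auto intro!: tendsto_intros)
  qed
  obtain F where F: "F holomorphic_on ball c r" "\<And>x. x \<in> ball c r \<Longrightarrow> G x = exp (F x)"
  proof (rule contractible_imp_holomorphic_log[OF G(1)])
    show "G x \<noteq> 0" if "x \<in> ball c r" for x using modG[OF that] by auto
  qed (auto intro: convex_imp_contractible)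
  have "u x = Re (F x)" if "x \<in> ball c r" for x
    using modG[OF that] F(2)[OF that] by simp
  with cu uv F(1) show ?thesis by (intro that)
qed

section \<open>Circle means and the local maximum principle\<close>

lemma has_integral_circle_Re:
  assumes r: "0 < r" and "continuous_on (cball c r) H" "H holomorphic_on ball c r"
  shows "((\<lambda>t. Re (H (c + of_real r * cis t))) has_integral 2 * pi * Re (H c)) {0..2*pi}"
proof -
  \<comment> \<open>Cauchy's formula at the centre: on the circle \<open>du / (u - c)\<close> is
    \<open>\<i> dt\<close>. The factor \<i> is the reason for taking the imaginary part at the
    end.\<close>
  have "((\<lambda>u. H u / (u - c)) has_contour_integral (2 * of_real pi * \<i> * H c)) (part_circlepath c r 0 (2*pi))"
    using Cauchy_integral_circlepath[OF assms(2,3), of c] r by (simp add: circlepath_def)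
  then have "((\<lambda>t. H (c + r * cis t) / (c + r * cis t - c) * r * \<i> * cis t)
      has_integral (2 * of_real pi * \<i> * H c)) {0..2*pi}"
    by (subst (asm) has_contour_integral_part_circlepath_iff) auto
  moreover have "(\<lambda>t. H (c + r * cis t) / (c + r * cis t - c) * r * \<i> * cis t) =
      (\<lambda>t. \<i> * H (c + of_real r * cis t))"
    using r by auto
  ultimately have "((\<lambda>t. \<i> * H (c + of_real r * cis t)) has_integral (2 * of_real pi * \<i> * H c)) {0..2*pi}"
    by metis
  from has_integral_linear[OF this bounded_linear_Im] show ?thesis
    by (simp add: o_def)
qed

text \<open>As \<open>e2ennreal\<close> truncates at 0, the two integrals in
  \<open>circle_mean\<close> are those of the positive and negative parts; for continuous
  \<open>v\<close> both are finite and recombine to the ordinary integral.\<close>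

lemma circle_mean_ereal:
  assumes "continuous_on (sphere c r) v" and r: "0 < r"
  shows "circle_mean (\<lambda>w. ereal (v w)) c r =
    ereal (integral {0..2*pi} (\<lambda>t. v (c + of_real r * cis t)) / (2 * pi))"
proof -
  define g where "g t = v (c + of_real r * cis t)" for t
  have cg: "continuous_on {0..2*pi} g"
    unfolding g_def using r
    by (intro continuous_on_compose2[OF assms(1)]) (auto intro!: continuous_intros simp: dist_norm norm_mult)
  define P where "P = integral {0..2*pi} (\<lambda>t. max 0 (g t))"
  define N where "N = integral {0..2*pi} (\<lambda>t. max 0 (- g t))"
  have hP: "((\<lambda>t. max 0 (g t)) has_integral P) {0..2*pi}"
    unfolding P_def by (intro integrable_integral integrable_continuous_real continuous_intros cg)
  have hN: "((\<lambda>t. max 0 (- g t)) has_integral N) {0..2*pi}"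
    unfolding N_def by (intro integrable_integral integrable_continuous_real continuous_intros cg)
  have e: "e2ennreal (ereal x) = ennreal (max 0 x)" for x
    by (simp add: ennreal_neg max_def)
  have 1: "(\<integral>\<^sup>+t\<in>{0..2 * pi}. e2ennreal (ereal (g t)) \<partial>lborel) = ennreal P"
    unfolding e by (rule nn_integral_has_integral_lebesgue'[OF _ hP]) auto
  have 2: "(\<integral>\<^sup>+t\<in>{0..2 * pi}. e2ennreal (- ereal (g t)) \<partial>lborel) = ennreal N"
    unfolding uminus_ereal.simps e by (rule nn_integral_has_integral_lebesgue'[OF _ hN]) auto
  have "P \<ge> 0" by (rule has_integral_nonneg[OF hP]) auto
  moreover have "N \<ge> 0" by (rule has_integral_nonneg[OF hN]) auto
  moreover have "P - N = integral {0..2*pi} g"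
  proof -
    have "((\<lambda>t. max 0 (g t) - max 0 (- g t)) has_integral P - N) {0..2*pi}"
      by (rule has_integral_diff[OF hP hN])
    moreover have "(\<lambda>t. max 0 (g t) - max 0 (- g t)) = g" by (auto simp: max_def)
    ultimately show ?thesis by (simp add: integral_unique)
  qed
  ultimately show ?thesis
    unfolding circle_mean_def g_def[symmetric] 1 2 by (simp add: enn2ereal_ennreal)
qed

text \<open>Contact at the centre turns the mean value inequality into an upper bound 0 for the
  integral of the nonnegative continuous function \<open>D\<close>, which must then vanish on the
  circle. Each point of the disc lies on such a circle.\<close>

lemma subharmonic_imp_subh:
  assumes v: "continuous_on UNIV v" and sub: "subharmonic_on UNIV (\<lambda>w. ereal (v w))"
  shows "subh UNIV v"
proof (rule subhI)
  fix p H and e :: real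
  assume e: "0 < e" and H: "H holomorphic_on ball p e"
    and le: "\<And>x. x \<in> ball p e \<Longrightarrow> v x \<le> Re (H x)" and eq: "v p = Re (H p)"
  have "v x = Re (H x)" if x: "x \<in> ball p e" for x
  proof (cases "x = p")
    case False
    define r where "r = dist p x"
    have r: "0 < r" "cball p r \<subseteq> ball p e" using x False by (auto simp: r_def)
    define D where "D t = Re (H (p + of_real r * cis t)) - v (p + of_real r * cis t)" for t
    have "p + of_real r * cis t \<in> cball p r" for t
      using r(1) by (auto simp: dist_norm norm_mult)
    then have circ: "p + of_real r * cis t \<in> ball p e" for t
      using r(2) by blast
    have cv: "continuous_on {0..2*pi} (\<lambda>t. v (p + of_real r * cis t))"
      by (intro continuous_on_compose2[OF v]) (auto intro!: continuous_intros)
    have cH: "continuous_on {0..2*pi} (\<lambda>t. Re (H (p + of_real r * cis t)))"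
      by (intro continuous_intros continuous_on_compose2[OF holomorphic_on_imp_continuous_on[OF H]])
        (use circ in blast)
    have "ereal (v p) \<le> circle_mean (\<lambda>w. ereal (v w)) p r"
      using sub r unfolding subharmonic_on_def by auto
    also have "\<dots> = ereal (integral {0..2*pi} (\<lambda>t. v (p + of_real r * cis t)) / (2 * pi))"
      by (rule circle_mean_ereal[OF continuous_on_subset[OF v] r(1)]) simp
    finally have "2 * pi * v p \<le> integral {0..2*pi} (\<lambda>t. v (p + of_real r * cis t))"
      by (simp add: field_simps)
    moreover have int: "((\<lambda>t. Re (H (p + of_real r * cis t))) has_integral 2 * pi * Re (H p)) {0..2*pi}"
      using r by (intro has_integral_circle_Re holomorphic_on_imp_continuous_on holomorphic_on_subset[OF H])
        auto
    have hD: "(D has_integral 2 * pi * Re (H p) - integral {0..2*pi} (\<lambda>t. v (p + of_real r * cis t))) {0..2*pi}"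
      unfolding D_def by (intro has_integral_diff int integrable_integral integrable_continuous_real cv)
    have D0: "D t \<ge> 0" for t using le[OF circ[of t]] by (simp add: D_def)
    have "2 * pi * Re (H p) - integral {0..2*pi} (\<lambda>t. v (p + of_real r * cis t)) \<ge> 0"
      by (rule has_integral_nonneg[OF hD D0])
    ultimately have "(D has_integral 0) (cbox 0 (2*pi))" using hD eq by (simp add: antisym)
    moreover have "continuous_on (cbox 0 (2*pi)) D"
      unfolding D_def cbox_interval by (intro continuous_intros cv cH)
    moreover have "box 0 (2 * pi) \<noteq> {}" using pi_gt_zero by (simp add: not_le)
    ultimately have Dz: "D t = 0" if "t \<in> {0..2*pi}" for t
      using D0 that by (intro has_integral_0_cbox_imp_0[of 0 "2*pi" D t]) auto
    obtain t where t: "t \<in> {0..2*pi}" "x = p + of_real r * cis t"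
    proof
      show "Arg2pi (x - p) \<in> {0..2*pi}" using Arg2pi[of "x - p"] by auto
      show "x = p + of_real r * cis (Arg2pi (x - p))"
        using Arg2pi_eq[of "x - p"] by (simp add: r_def dist_norm norm_minus_commute cis_conv_exp)
    qed
    then show ?thesis using Dz[OF t(1)] by (simp add: D_def)
  qed (use eq in simp)
  then show "\<forall>\<^sub>F x in nhds p. v x = Re (H x)"
    using eventually_nhds_in_open[of "ball p e" p] e by (auto elim!: eventually_mono)
qed

text \<open>The value at the centre is compared with an entire function that approximates
  \<open>v\<close> on the circle and satisfies the mean value equality exactly.\<close>

lemma subh_imp_subharmonic:
  assumes v: "continuous_on UNIV v" and sub: "subh UNIV v"
  shows "subharmonic_on UNIV (\<lambda>w. ereal (v w))"
  unfolding subharmonic_on_def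
proof (intro conjI allI impI)
  show "usc_on UNIV (\<lambda>w. ereal (v w))"
    unfolding usc_on_def
  proof (intro ballI allI impI)
    fix x t assume "ereal (v x) < t"
    moreover have "((\<lambda>w. ereal (v w)) \<longlongrightarrow> ereal (v x)) (at x)"
      using v by (auto simp: continuous_on_def)
    ultimately show "\<forall>\<^sub>F y in at x. ereal (v y) < t" by (rule order_tendstoD(2)[rotated])
  qed
  fix c and r :: real assume r: "0 < r"
  have cv: "(\<lambda>t. v (c + of_real r * cis t)) integrable_on {0..2*pi}"
    by (intro integrable_continuous_real continuous_on_compose2[OF v]) (auto intro!: continuous_intros)
  let ?I = "integral {0..2*pi} (\<lambda>t. v (c + of_real r * cis t))"
  have "2 * pi * v c \<le> ?I"
  proof (rule field_le_epsilon)
    fix \<epsilon> :: real assume \<epsilon>: "\<epsilon> > 0"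
    \<comment> \<open>The tolerance enters twice, at the centre and in the integral, each time with
      the factor \<open>2 * pi\<close>.\<close>
    define d where "d = \<epsilon> / (4 * pi)"
    have d: "d > 0" using \<epsilon> by (simp add: d_def)
    obtain H where H: "H holomorphic_on UNIV" "\<And>x. x \<in> sphere c r \<Longrightarrow> \<bar>v x - Re (H x)\<bar> < d"
      using Re_entire_approx_on_sphere[OF r continuous_on_subset[OF v] d] by blast
    have Hon: "H holomorphic_on S" for S using H(1) holomorphic_on_subset by blast
    have Hc: "continuous_on S H" for S using Hon holomorphic_on_imp_continuous_on by blast
    have "v c \<le> Re (H c + of_real d)"
    proof (rule subh_le_Re_cball[OF r, where c = c and v = v and H = "\<lambda>x. H x + of_real d"])
      show "v x \<le> Re (H x + of_real d)" if "x \<in> sphere c r" for x using H(2)[OF that] by simp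
      show "subh (ball c r) v" by (rule subh_subset[OF sub]) simp
      show "continuous_on (cball c r) v" by (rule continuous_on_subset[OF v]) simp
    qed (use r in \<open>auto intro!: continuous_intros holomorphic_intros Hc Hon\<close>)
    then have "2 * pi * v c \<le> 2 * pi * (Re (H c) + d)" by (intro mult_left_mono) auto
    also have "\<dots> = 2 * pi * Re (H c) + 2 * pi * d" by (simp add: algebra_simps)
    also have "2 * pi * Re (H c) \<le> integral {0..2*pi} (\<lambda>t. v (c + of_real r * cis t) + d)"
    proof (rule has_integral_le)
      show "((\<lambda>t. Re (H (c + of_real r * cis t))) has_integral 2 * pi * Re (H c)) {0..2*pi}"
        by (intro has_integral_circle_Re r Hc Hon)
      show "((\<lambda>t. v (c + of_real r * cis t) + d) has_integral integral {0..2*pi} (\<lambda>t. v (c + of_real r * cis t) + d)) {0..2*pi}"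
        by (intro integrable_integral integrable_add cv) auto
      show "Re (H (c + of_real r * cis t)) \<le> v (c + of_real r * cis t) + d" for t
        using H(2)[of "c + of_real r * cis t"] r by (auto simp: dist_norm norm_mult)
    qed
    also have "integral {0..2*pi} (\<lambda>t. v (c + of_real r * cis t) + d) = ?I + 2 * pi * d"
      using cv by (subst integral_add) auto
    finally show "2 * pi * v c \<le> ?I + \<epsilon>"
      by (simp add: d_def)
  qed
  moreover have "circle_mean (\<lambda>w. ereal (v w)) c r = ereal (?I / (2 * pi))"
    by (rule circle_mean_ereal[OF continuous_on_subset[OF v] r]) simp
  ultimately show "ereal (v c) \<le> circle_mean (\<lambda>w. ereal (v w)) c r"
    by (simp add: field_simps)
qed auto

section \<open>Composition, Harnack's inequality and harmonic functions\<close>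

text \<open>The tests at \<open>p\<close> see a neighbourhood of \<open>p\<close> in the plane and
  not the set, so even a singleton \<open>T\<close> is meaningful; this is used to glue functions
  along a circle.\<close>

lemma subh_local:
  assumes "\<And>p. p \<in> S \<Longrightarrow> \<exists>T. p \<in> T \<and> subh T v"
  shows "subh S v"
  using assms unfolding subh_def by blast

text \<open>Where \<open>w\<close> has a local holomorphic inverse \<open>g\<close>, a test function
  \<open>H\<close> for the composite becomes the test function \<open>H \<circ> g\<close> for
  \<open>v\<close>.\<close>

lemma subh_compose_noncritical:
  assumes S: "open S" "subh S v" and D: "open D" "w holomorphic_on D" "w ` D \<subseteq> S"
    and nz: "\<And>z. z \<in> D \<Longrightarrow> deriv w z \<noteq> 0"
  shows "subh D (\<lambda>z. v (w z))"
proof (rule subhI)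
  fix p H and e :: real
  assume p: "p \<in> D" and e: "0 < e" and H: "H holomorphic_on ball p e"
    and le: "\<And>x. x \<in> ball p e \<Longrightarrow> v (w x) \<le> Re (H x)" and eq: "v (w p) = Re (H p)"
  define D' where "D' = D \<inter> ball p e"
  have D': "open D'" "p \<in> D'" "w holomorphic_on D'"
    using p e D holomorphic_on_subset unfolding D'_def by (auto simp: open_Int)
  obtain r where r: "r > 0" "ball p r \<subseteq> D'" "open (w ` ball p r)" "inj_on w (ball p r)"
    using has_complex_derivative_locally_invertible[OF D'(3,2,1) nz[OF p]] by blast
  have wr: "w holomorphic_on ball p r" using D'(3) r(2) by (rule holomorphic_on_subset)
  obtain g where g: "g holomorphic_on (w ` ball p r)" "\<And>z. z \<in> ball p r \<Longrightarrow> g (w z) = z"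
    by (rule holomorphic_has_inverse[OF wr open_ball r(4)]) blast
  have "w p \<in> w ` ball p r" using r by auto
  then obtain s where s: "s > 0" "ball (w p) s \<subseteq> w ` ball p r" using r(3) openE by blast
  have gs: "g ` ball (w p) s \<subseteq> ball p e"
  proof
    fix y assume "y \<in> g ` ball (w p) s"
    then obtain z where "z \<in> ball p r" "y = g (w z)" using s(2) by blast
    then show "y \<in> ball p e" using g(2) r(2) by (auto simp: D'_def)
  qed
  have "\<forall>\<^sub>F y in nhds (w p). v y = Re (H (g y))"
  proof (rule subhD[OF S(2) _ s(1)])
    show "w p \<in> S" using p D by blast
    have "(H \<circ> g) holomorphic_on ball (w p) s"
      by (rule holomorphic_on_compose_gen[OF holomorphic_on_subset[OF g(1) s(2)] H gs])
    then show "(\<lambda>y. H (g y)) holomorphic_on ball (w p) s" by (simp add: o_def)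
    show "v y \<le> Re (H (g y))" if y: "y \<in> ball (w p) s" for y
    proof -
      obtain z where "z \<in> ball p r" "y = w z" using y s(2) by blast
      then show ?thesis using g(2)[of z] le[of z] r(2) by (auto simp: D'_def)
    qed
    show "v (w p) = Re (H (g (w p)))" using eq g(2)[of p] r(1) by simp
  qed
  moreover have "filterlim w (nhds (w p)) (nhds p)"
  proof -
    have "isCont w p"
      using holomorphic_on_imp_continuous_on[OF D(2)] D(1) p by (simp add: continuous_on_eq_continuous_at)
    then show ?thesis by (simp add: isCont_def tendsto_at_iff_tendsto_nhds)
  qed
  ultimately have "\<forall>\<^sub>F x in nhds p. v (w x) = Re (H (g (w x)))"
    by (rule eventually_compose_filterlim)
  moreover have "\<forall>\<^sub>F x in nhds p. x \<in> ball p r"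
    using r(1) by (intro eventually_nhds_in_open) auto
  ultimately show "\<forall>\<^sub>F x in nhds p. v (w x) = Re (H x)"
    by eventually_elim (use g(2) in simp)
qed

text \<open>By the identity theorem the critical points of \<open>w\<close> near \<open>p\<close>
  either fill a disc, on which the composite is constant, or leave a punctured disc around
  \<open>p\<close> free.\<close>

theorem subh_compose:
  assumes S: "open S" "continuous_on S v" "subh S v"
    and D: "open D" "w holomorphic_on D" "w ` D \<subseteq> S"
  shows "subh D (\<lambda>z. v (w z))"
proof (rule subh_local)
  fix p assume p: "p \<in> D"
  then obtain d where d: "d > 0" "ball p d \<subseteq> D" using D(1) openE by blast
  have wd: "w holomorphic_on ball p d" using D(2) d(2) by (rule holomorphic_on_subset)
  have dw: "deriv w holomorphic_on ball p d" by (rule holomorphic_deriv[OF wd]) simp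
  show "\<exists>T. p \<in> T \<and> subh T (\<lambda>z. v (w z))"
  proof (cases "\<forall>z\<in>ball p d. deriv w z = 0")
    case True
    have "\<exists>k. \<forall>z\<in>ball p d. w z = k"
    proof (rule has_field_derivative_zero_constant)
      show "(w has_field_derivative 0) (at x within ball p d)" if "x \<in> ball p d" for x
        using holomorphic_derivI[OF wd open_ball that, of "ball p d"] True that by simp
    qed auto
    then obtain k where k: "\<And>z. z \<in> ball p d \<Longrightarrow> w z = k" by blast
    have "subh (ball p d) (\<lambda>z. Re (of_real (v k)))" by (rule subh_Re) auto
    then have "subh (ball p d) (\<lambda>z. v (w z))"
      unfolding subh_def
    proof (intro ballI allI impI)
      fix q H and e :: real
      assume c: "\<forall>p\<in>ball p d. \<forall>H e. 0 < e \<longrightarrow> H holomorphic_on ball p e \<longrightarrow>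
          (\<forall>x\<in>ball p e. Re (complex_of_real (v k)) \<le> Re (H x)) \<longrightarrow> Re (complex_of_real (v k)) = Re (H p) \<longrightarrow>
          (\<forall>\<^sub>F x in nhds p. Re (complex_of_real (v k)) = Re (H x))"
        and q: "q \<in> ball p d" and e: "0 < e" and H: "H holomorphic_on ball q e"
        and le: "\<forall>x\<in>ball q e. v (w x) \<le> Re (H x)" and eq: "v (w q) = Re (H q)"
      obtain s where s: "s > 0" "ball q s \<subseteq> ball p d" using q openE[OF open_ball q] by blast
      define t where "t = min s e"
      have t: "t > 0" "ball q t \<subseteq> ball p d" "ball q t \<subseteq> ball q e" using s e by (auto simp: t_def)
      have "\<forall>x\<in>ball q t. Re (complex_of_real (v k)) \<le> Re (H x)"
      proof
        fix x assume "x \<in> ball q t"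
        then have "x \<in> ball p d" "x \<in> ball q e" using t by auto
        then show "Re (complex_of_real (v k)) \<le> Re (H x)" using le k by force
      qed
      moreover have "Re (complex_of_real (v k)) = Re (H q)" using eq k[OF q] by simp
      ultimately have "\<forall>\<^sub>F x in nhds q. Re (complex_of_real (v k)) = Re (H x)"
        using c q t(1) holomorphic_on_subset[OF H t(3)] by blast
      moreover have "\<forall>\<^sub>F x in nhds q. x \<in> ball p d"
        using q by (intro eventually_nhds_in_open) auto
      ultimately show "\<forall>\<^sub>F x in nhds q. v (w x) = Re (H x)"
        by eventually_elim (use k in simp)
    qed
    then show ?thesis using d(1) by (intro exI[of _ "ball p d"]) auto
  next
    case False
    then obtain \<beta> where \<beta>: "\<beta> \<in> ball p d" "deriv w \<beta> \<noteq> 0" by blast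
    have "\<exists>r>0. ball p r \<subseteq> ball p d \<and> (\<forall>z\<in>ball p r - {p}. deriv w z \<noteq> 0)"
    proof (cases "deriv w p = 0")
      case True
      show ?thesis
        by (rule isolated_zeros[OF dw open_ball connected_ball _ True \<beta>]) (use d in auto)
    next
      case nz: False
      have "continuous_on (ball p d) (deriv w)" using dw by (rule holomorphic_on_imp_continuous_on)
      then have "isCont (deriv w) p" using d(1) by (simp add: continuous_on_eq_continuous_at)
      then obtain r where r: "r > 0" "\<And>y. dist p y < r \<Longrightarrow> deriv w y \<noteq> 0"
        using continuous_at_avoid[of p "deriv w" 0] nz by blast
      then show ?thesis using d(1) by (intro exI[of _ "min r d"]) auto
    qed
    then obtain r where r: "r > 0" "ball p r \<subseteq> ball p d" "\<And>z. z \<in> ball p r - {p} \<Longrightarrow> deriv w z \<noteq> 0"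
      by blast
    have rD: "ball p r \<subseteq> D" using r(2) d(2) by blast
    have "subh (ball p r) (\<lambda>z. v (w z))"
    proof (rule subh_removable)
      show "subh (ball p r - {p}) (\<lambda>z. v (w z))"
        by (rule subh_compose_noncritical[OF S(1,3)])
          (use rD r D in \<open>auto simp: open_Diff subset_iff intro: holomorphic_on_subset\<close>)
      show "continuous_on (ball p r) (\<lambda>z. v (w z))"
        by (rule continuous_on_compose2[OF S(2)])
          (use rD D in \<open>auto simp: subset_iff intro!: holomorphic_on_imp_continuous_on intro: holomorphic_on_subset\<close>)
    qed simp
    then show ?thesis using r(1) by (intro exI[of _ "ball p r"]) auto
  qed
qed

section \<open>Harnack's inequality for holomorphic functions with positive real part\<close>

lemma Harnack_Re_pos_0:
  assumes r: "0 < r" and H: "H holomorphic_on ball 0 r" "\<And>z. z \<in> ball 0 r \<Longrightarrow> 0 < Re (H z)"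
    and s: "s < 1" "cmod x \<le> s * r"
  shows "cmod (H x) \<le> (1 + s) / (1 - s) * cmod (H 0)"
proof -
  \<comment> \<open>The Cayley transform that takes the right half plane to the unit disc and
    \<open>H 0\<close> to 0. Schwarz's lemma for \<open>F\<close>, solved for the modulus of
    \<open>H x\<close>, is the claim.\<close>
  define F where "F \<zeta> = (H (of_real r * \<zeta>) - H 0) / (H (of_real r * \<zeta>) + cnj (H 0))" for \<zeta>
  have inb: "of_real r * \<zeta> \<in> ball 0 r" if "\<zeta> \<in> ball 0 1" for \<zeta> :: complex
    using that r by (simp add: norm_mult)
  have pos: "0 < Re (H (of_real r * \<zeta>) + cnj (H 0))" if "\<zeta> \<in> ball 0 1" for \<zeta>
    using H(2)[OF inb[OF that]] H(2)[of 0] r by simp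
  then have den: "H (of_real r * \<zeta>) + cnj (H 0) \<noteq> 0" if "\<zeta> \<in> ball 0 1" for \<zeta>
    using that by fastforce
  have holH: "(\<lambda>\<zeta>. H (of_real r * \<zeta>)) holomorphic_on ball 0 1"
  proof -
    have "H \<circ> (\<lambda>\<zeta>. of_real r * \<zeta>) holomorphic_on ball 0 1"
      by (rule holomorphic_on_compose_gen[OF _ H(1)]) (use inb in \<open>auto intro!: holomorphic_intros\<close>)
    then show ?thesis by (simp add: o_def)
  qed
  have F1: "cmod (F \<zeta>) < 1" if "cmod \<zeta> < 1" for \<zeta>
  proof -
    let ?a = "H (of_real r * \<zeta>)" and ?b = "H 0"
    have z: "\<zeta> \<in> ball 0 1" using that by simp
    have "0 < Re ?a * Re ?b" using H(2)[OF inb[OF z]] H(2)[of 0] r by simp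
    moreover have "(cmod (?a + cnj ?b))\<^sup>2 - (cmod (?a - ?b))\<^sup>2 = 4 * (Re ?a * Re ?b)"
      unfolding cmod_power2 by (simp add: power2_eq_square algebra_simps)
    ultimately have "(cmod (?a - ?b))\<^sup>2 < (cmod (?a + cnj ?b))\<^sup>2" by linarith
    then have "cmod (?a - ?b) < cmod (?a + cnj ?b)" by (rule power2_less_imp_less) simp
    then show ?thesis using den[OF z] by (simp add: F_def norm_divide divide_simps)
  qed
  have F: "cmod (F \<xi>) \<le> cmod \<xi>" if "cmod \<xi> < 1" for \<xi>
  proof (rule Schwarz_Lemma(1)[OF _ _ F1 that])
    show "F holomorphic_on ball 0 1"
      unfolding F_def using den by (intro holomorphic_intros holH) auto
  qed (auto simp: F_def)
  define \<xi> where "\<xi> = x / of_real r"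
  have \<xi>: "cmod \<xi> \<le> s" using s r by (simp add: \<xi>_def norm_divide divide_simps)
  have x: "of_real r * \<xi> = x" using r by (simp add: \<xi>_def)
  have z: "\<xi> \<in> ball 0 1" using \<xi> s by simp
  have "cmod (F \<xi>) \<le> s" using F[of \<xi>] \<xi> s by simp
  then have "cmod (H x - H 0) \<le> s * cmod (H x + cnj (H 0))"
    using den[OF z] unfolding F_def x by (simp add: norm_divide divide_simps)
  moreover have "cmod (H x) - cmod (H 0) \<le> cmod (H x - H 0)" by (rule norm_triangle_ineq2)
  moreover have "cmod (H x + cnj (H 0)) \<le> cmod (H x) + cmod (H 0)"
    using norm_triangle_ineq[of "H x" "cnj (H 0)"] by simp
  moreover have "0 \<le> s" using \<xi> norm_ge_zero order_trans by blast
  ultimately have "cmod (H x) - cmod (H 0) \<le> s * (cmod (H x) + cmod (H 0))"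
    by (meson mult_left_mono order_trans)
  then show ?thesis using s by (simp add: field_simps)
qed

text \<open>The centre is eliminated by going from \<open>x\<close> to 0 and from 0 to
  \<open>y\<close>. The first half is the central estimate for \<open>inverse H\<close>, which also
  has positive real part.\<close>

lemma Harnack_Re_pos:
  assumes r: "0 < r" and H: "H holomorphic_on ball 0 r" "\<And>z. z \<in> ball 0 r \<Longrightarrow> 0 < Re (H z)"
    and s: "s < 1" "cmod x \<le> s * r" "cmod y \<le> s * r"
  shows "cmod (H y) \<le> ((1 + s) / (1 - s))\<^sup>2 * cmod (H x)"
proof -
  have s0: "0 \<le> s" using s(2) r by (metis norm_ge_zero order_trans zero_le_mult_iff not_less)
  have nz: "H z \<noteq> 0" if "z \<in> ball 0 r" for z using H(2)[OF that] by auto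
  have "s * r < 1 * r" using s(1) r by (rule mult_strict_right_mono)
  then have xr: "x \<in> ball 0 r" using s(2) by simp
  have "cmod (inverse (H x)) \<le> (1 + s) / (1 - s) * cmod (inverse (H 0))"
  proof (rule Harnack_Re_pos_0[OF r _ _ s(1,2)])
    show "(\<lambda>z. inverse (H z)) holomorphic_on ball 0 r"
      using nz by (intro holomorphic_intros H) auto
    show "0 < Re (inverse (H z))" if "z \<in> ball 0 r" for z
      using H(2)[OF that] unfolding inverse_complex.sel
      by (intro divide_pos_pos add_pos_nonneg) auto
  qed
  moreover have "b \<le> k * a" if "inverse a \<le> k * inverse b" "0 < a" "0 < b" for a b k :: real
    using that by (simp add: field_simps)
  ultimately have "cmod (H 0) \<le> (1 + s) / (1 - s) * cmod (H x)"
    using nz[OF xr] nz[of 0] r by (simp add: norm_inverse del: times_divide_eq_left)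
  moreover have "0 \<le> (1 + s) / (1 - s)" using s0 s(1) by simp
  ultimately have "(1 + s) / (1 - s) * cmod (H 0) \<le> (1 + s) / (1 - s) * ((1 + s) / (1 - s) * cmod (H x))"
    by (rule mult_left_mono)
  from order_trans[OF Harnack_Re_pos_0[OF r H s(1,3)] this] show ?thesis
    by (simp only: power2_eq_square mult.assoc)
qed

section \<open>Vanishing Laplacian versus real parts of holomorphic functions\<close>

lemma Re_has_derivative:
  assumes "F holomorphic_on S" "open S" "p \<in> S"
  shows "((\<lambda>x. Re (F x)) has_derivative (\<lambda>h. Re (deriv F p) * Re h + Re (\<i> * deriv F p) * Im h)) (at p)"
proof -
  have "(F has_derivative (\<lambda>h. deriv F p * h)) (at p)"
    using holomorphic_derivI[OF assms] by (simp add: has_field_derivative_def)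
  then have "((\<lambda>x. Re (F x)) has_derivative (\<lambda>h. Re (deriv F p * h))) (at p)"
    by (rule has_derivative_Re)
  then show ?thesis by (simp add: algebra_simps)
qed

text \<open>Differentiating in the imaginary direction multiplies the complex derivative by \<i>, so
  the Laplacian is the real part of \<open>F'' + \<i> * \<i> * F''\<close>.\<close>

lemma harmonic_on_Re:
  assumes F: "F holomorphic_on S" and S: "open S"
  shows "harmonic_on S (\<lambda>x. Re (F x))"
proof -
  define F1 where "F1 = deriv F"
  define F2 where "F2 = deriv F1"
  have F1: "F1 holomorphic_on S" unfolding F1_def by (rule holomorphic_deriv[OF F S])
  have F2: "F2 holomorphic_on S" unfolding F2_def by (rule holomorphic_deriv[OF F1 S])
  have iF1: "(\<lambda>p. \<i> * F1 p) holomorphic_on S" by (intro holomorphic_intros F1)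
  have d: "deriv (\<lambda>p. \<i> * F1 p) p = \<i> * F2 p" if "p \<in> S" for p
    unfolding F2_def using F1 S that
    by (intro deriv_cmult) (simp add: holomorphic_on_imp_differentiable_at)
  have c: "continuous_on S F2" using F2 by (rule holomorphic_on_imp_continuous_on)
  show ?thesis
    unfolding harmonic_on_def
  proof (intro conjI exI ballI S)
    fix p assume p: "p \<in> S"
    show "((\<lambda>x. Re (F x)) has_derivative (\<lambda>h. Re (F1 p) * Re h + Re (\<i> * F1 p) * Im h)) (at p)"
      using Re_has_derivative[OF F S p] by (simp add: F1_def)
    show "((\<lambda>x. Re (F1 x)) has_derivative (\<lambda>h. Re (F2 p) * Re h + Re (\<i> * F2 p) * Im h)) (at p)"
      using Re_has_derivative[OF F1 S p] by (simp add: F2_def)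
    show "((\<lambda>x. Re (\<i> * F1 x)) has_derivative (\<lambda>h. Re (\<i> * F2 p) * Re h + Re (\<i> * (\<i> * F2 p)) * Im h)) (at p)"
      using Re_has_derivative[OF iF1 S p] d[OF p] by simp
    show "Re (F2 p) + Re (\<i> * (\<i> * F2 p)) = 0" by simp
  qed (intro continuous_intros c)+
qed

lemma harmonic_on_diff:
  assumes "harmonic_on S u" "harmonic_on S v"
  shows "harmonic_on S (\<lambda>x. u x - v x)"
proof -
  obtain ux uy uxx uxy uyx uyy where u: "open S"
    "\<And>p. p \<in> S \<Longrightarrow> (u has_derivative (\<lambda>h. ux p * Re h + uy p * Im h)) (at p)"
    "\<And>p. p \<in> S \<Longrightarrow> (ux has_derivative (\<lambda>h. uxx p * Re h + uxy p * Im h)) (at p)"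
    "\<And>p. p \<in> S \<Longrightarrow> (uy has_derivative (\<lambda>h. uyx p * Re h + uyy p * Im h)) (at p)"
    "continuous_on S uxx" "continuous_on S uxy" "continuous_on S uyx" "continuous_on S uyy"
    "\<And>p. p \<in> S \<Longrightarrow> uxx p + uyy p = 0"
    using assms(1) unfolding harmonic_on_def by blast
  obtain vx vy vxx vxy vyx vyy where v: "open S"
    "\<And>p. p \<in> S \<Longrightarrow> (v has_derivative (\<lambda>h. vx p * Re h + vy p * Im h)) (at p)"
    "\<And>p. p \<in> S \<Longrightarrow> (vx has_derivative (\<lambda>h. vxx p * Re h + vxy p * Im h)) (at p)"
    "\<And>p. p \<in> S \<Longrightarrow> (vy has_derivative (\<lambda>h. vyx p * Re h + vyy p * Im h)) (at p)"
    "continuous_on S vxx" "continuous_on S vxy" "continuous_on S vyx" "continuous_on S vyy"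
    "\<And>p. p \<in> S \<Longrightarrow> vxx p + vyy p = 0"
    using assms(2) unfolding harmonic_on_def by blast
  have diff: "((\<lambda>x. f x - g x) has_derivative (\<lambda>h. (a - b) * Re h + (a' - b') * Im h)) (at p)"
    if "(f has_derivative (\<lambda>h. a * Re h + a' * Im h)) (at p)"
      "(g has_derivative (\<lambda>h. b * Re h + b' * Im h)) (at p)" for f g a a' b b' p
    using has_derivative_diff[OF that] by (simp add: algebra_simps)
  show ?thesis
    unfolding harmonic_on_def
  proof (intro conjI exI ballI u(1))
    fix p assume p: "p \<in> S"
    show "((\<lambda>x. u x - v x) has_derivative (\<lambda>h. (ux p - vx p) * Re h + (uy p - vy p) * Im h)) (at p)"
      by (intro diff u v p)
    show "((\<lambda>x. ux x - vx x) has_derivative (\<lambda>h. (uxx p - vxx p) * Re h + (uxy p - vxy p) * Im h)) (at p)"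
      by (intro diff u v p)
    show "((\<lambda>x. uy x - vy x) has_derivative (\<lambda>h. (uyx p - vyx p) * Re h + (uyy p - vyy p) * Im h)) (at p)"
      by (intro diff u v p)
    show "uxx p - vxx p + (uyy p - vyy p) = 0" using u(9)[OF p] v(9)[OF p] by simp
  qed (intro continuous_intros u v)+
qed

lemma harmonic_on_subset:
  assumes "harmonic_on S u" "open T" "T \<subseteq> S"
  shows "harmonic_on T u"
proof -
  obtain ux uy uxx uxy uyx uyy where u:
    "\<And>p. p \<in> S \<Longrightarrow> (u has_derivative (\<lambda>h. ux p * Re h + uy p * Im h)) (at p)"
    "\<And>p. p \<in> S \<Longrightarrow> (ux has_derivative (\<lambda>h. uxx p * Re h + uxy p * Im h)) (at p)"
    "\<And>p. p \<in> S \<Longrightarrow> (uy has_derivative (\<lambda>h. uyx p * Re h + uyy p * Im h)) (at p)"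
    "continuous_on S uxx" "continuous_on S uxy" "continuous_on S uyx" "continuous_on S uyy"
    "\<And>p. p \<in> S \<Longrightarrow> uxx p + uyy p = 0"
    using assms(1) unfolding harmonic_on_def by blast
  show ?thesis
    unfolding harmonic_on_def
    by (rule conjI[OF assms(2)], rule exI[of _ ux], rule exI[of _ uy], rule exI[of _ uxx],
        rule exI[of _ uxy], rule exI[of _ uyx], rule exI[of _ uyy])
      (use u assms(3) in \<open>auto intro: continuous_on_subset\<close>)
qed

lemma harmonic_on_cong:
  assumes "harmonic_on S u" and eq: "\<And>x. x \<in> S \<Longrightarrow> u x = v x"
  shows "harmonic_on S v"
proof -
  obtain ux uy uxx uxy uyx uyy where u: "open S"
    "\<And>p. p \<in> S \<Longrightarrow> (u has_derivative (\<lambda>h. ux p * Re h + uy p * Im h)) (at p)"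
    "\<And>p. p \<in> S \<Longrightarrow> (ux has_derivative (\<lambda>h. uxx p * Re h + uxy p * Im h)) (at p)"
    "\<And>p. p \<in> S \<Longrightarrow> (uy has_derivative (\<lambda>h. uyx p * Re h + uyy p * Im h)) (at p)"
    "continuous_on S uxx" "continuous_on S uxy" "continuous_on S uyx" "continuous_on S uyy"
    "\<And>p. p \<in> S \<Longrightarrow> uxx p + uyy p = 0"
    using assms(1) unfolding harmonic_on_def by blast
  have "(v has_derivative (\<lambda>h. ux p * Re h + uy p * Im h)) (at p)" if "p \<in> S" for p
    by (rule has_derivative_transform_within_open[OF u(2)[OF that] u(1) that eq])
  with u show ?thesis
    unfolding harmonic_on_def by blast
qed

text \<open>If \<open>c\<close> were positive, \<open>f'\<close> would be positive just to the right
  of its zero at 0, and the mean value theorem would lift \<open>f\<close> above its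
  maximum.\<close>

lemma second_derivative_at_max:
  fixes f f' :: "real \<Rightarrow> real"
  assumes d: "0 < d" and f: "\<And>t. \<bar>t\<bar> < d \<Longrightarrow> (f has_real_derivative f' t) (at t)"
    and f': "(f' has_real_derivative c) (at 0)" and max: "\<And>t. \<bar>t\<bar> < d \<Longrightarrow> f t \<le> f 0"
  shows "c \<le> 0"
proof (rule ccontr)
  assume "\<not> c \<le> 0"
  then have c: "c > 0" by simp
  have "f' 0 = 0"
    by (rule DERIV_local_max[OF f d]) (use d max in auto)
  then obtain e where e: "e > 0" "\<And>h. 0 < h \<Longrightarrow> h < e \<Longrightarrow> 0 < f' h"
    using DERIV_pos_inc_right[OF f' c] by auto
  define h where "h = min d e / 2"
  have h: "0 < h" "h < d" "h < e" using d e by (auto simp: h_def)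
  obtain z where z: "0 < z" "z < h" "f h - f 0 = (h - 0) * f' z"
    using MVT2[of 0 h f f'] h f by force
  then have "f h - f 0 > 0" using e(2)[of z] h by simp
  then show False using max[of h] h by simp
qed

text \<open>Adding \<open>\<epsilon> * (|y - c|^2 - r^2)\<close>, which is 0 on the sphere, makes
  the Laplacian equal to \<open>4 * \<epsilon>\<close>. At an interior maximum, however, both pure
  second derivatives are nonpositive. This works directly with the partial derivatives of the
  definition.\<close>

lemma harmonic_max_principle:
  assumes r: "0 < r" and D: "harmonic_on (ball c r) D" "continuous_on (cball c r) D"
    and sph: "\<And>x. x \<in> sphere c r \<Longrightarrow> D x \<le> 0" and x: "x \<in> cball c r"
  shows "D x \<le> 0"
proof (rule ccontr)
  assume neg: "\<not> D x \<le> 0"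
  \<comment> \<open>The perturbation is at least \<open>- \<epsilon> * r^2\<close>, so
    \<open>\<psi> x\<close> keeps at least half of \<open>D x\<close>.\<close>
  define \<epsilon> where "\<epsilon> = D x / (2 * r\<^sup>2)"
  have \<epsilon>: "\<epsilon> > 0" "\<epsilon> * r\<^sup>2 < D x" using neg r by (auto simp: \<epsilon>_def)
  define \<psi> where "\<psi> y = D y + \<epsilon> * ((Re y - Re c)\<^sup>2 + (Im y - Im c)\<^sup>2 - r\<^sup>2)" for y
  have dist2: "(Re y - Re c)\<^sup>2 + (Im y - Im c)\<^sup>2 = (dist c y)\<^sup>2" for y
    by (simp add: dist_norm cmod_power2 power2_commute)
  have "continuous_on (cball c r) \<psi>" unfolding \<psi>_def by (intro continuous_intros D(2))
  then obtain p where p: "p \<in> cball c r" "\<And>y. y \<in> cball c r \<Longrightarrow> \<psi> y \<le> \<psi> p"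
    using continuous_attains_sup[of "cball c r" \<psi>] x compact_cball by blast
  have "\<psi> x > 0"
  proof -
    have "\<epsilon> * (dist c x)\<^sup>2 \<ge> 0" using \<epsilon>(1) by simp
    then show ?thesis using \<epsilon>(2) unfolding \<psi>_def dist2 by (simp add: right_diff_distrib)
  qed
  then have "\<psi> p > 0" using p(2)[OF x] by linarith
  then have "p \<notin> sphere c r" using sph[of p] by (auto simp: \<psi>_def dist2)
  then have pb: "p \<in> ball c r" using p(1) by auto
  then obtain d where d: "d > 0" "ball p d \<subseteq> ball c r" using openE[OF open_ball pb] by blast
  obtain ux uy uxx uxy uyx uyy where u:
    "\<And>p. p \<in> ball c r \<Longrightarrow> (D has_derivative (\<lambda>h. ux p * Re h + uy p * Im h)) (at p)"
    "\<And>p. p \<in> ball c r \<Longrightarrow> (ux has_derivative (\<lambda>h. uxx p * Re h + uxy p * Im h)) (at p)"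
    "\<And>p. p \<in> ball c r \<Longrightarrow> (uy has_derivative (\<lambda>h. uyx p * Re h + uyy p * Im h)) (at p)"
    "\<And>p. p \<in> ball c r \<Longrightarrow> uxx p + uyy p = 0"
    using D(1) unfolding harmonic_on_def by blast
  have chain: "((\<lambda>t. g (p + of_real t * e)) has_real_derivative (a * Re e + b * Im e)) (at t)"
    if "(g has_derivative (\<lambda>h. a * Re h + b * Im h)) (at (p + of_real t * e))" for g :: "complex \<Rightarrow> real" and a b e t
  proof -
    have 1: "((\<lambda>t. p + of_real t * e) has_derivative (\<lambda>h. of_real h * e)) (at t)"
      by (auto intro!: derivative_eq_intros)
    have "((\<lambda>t. g (p + of_real t * e)) has_derivative (\<lambda>h. a * Re (of_real h * e) + b * Im (of_real h * e))) (at t)"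
      by (rule has_derivative_compose[OF 1 that])
    moreover have "(\<lambda>h. a * Re (of_real h * e) + b * Im (of_real h * e)) = (*) (a * Re e + b * Im e)"
      by (auto simp: algebra_simps)
    ultimately show ?thesis by (simp add: has_field_derivative_def)
  qed
  have inx: "p + of_real t * 1 \<in> ball c r" "p + of_real t * \<i> \<in> ball c r" if "\<bar>t\<bar> < d" for t
    using that d(2) by (auto simp: dist_norm subset_iff norm_mult)
  have maxx: "\<psi> (p + of_real t * 1) \<le> \<psi> (p + of_real 0 * 1)" "\<psi> (p + of_real t * \<i>) \<le> \<psi> (p + of_real 0 * \<i>)"
    if "\<bar>t\<bar> < d" for t
    using p(2)[of "p + of_real t * 1"] p(2)[of "p + of_real t * \<i>"] inx[OF that] by auto
  have "uxx p + 2 * \<epsilon> \<le> 0"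
  proof (rule second_derivative_at_max[OF d(1), where f = "\<lambda>t. \<psi> (p + of_real t * 1)" and
        f' = "\<lambda>t. ux (p + of_real t * 1) + 2 * \<epsilon> * (Re p + t - Re c)"])
    show "((\<lambda>t. \<psi> (p + of_real t * 1)) has_real_derivative
        ux (p + of_real t * 1) + 2 * \<epsilon> * (Re p + t - Re c)) (at t)" if "\<bar>t\<bar> < d" for t
      unfolding \<psi>_def using chain[OF u(1)[OF inx(1)[OF that]]]
      by (auto intro!: derivative_eq_intros simp: algebra_simps)
    show "((\<lambda>t. ux (p + of_real t * 1) + 2 * \<epsilon> * (Re p + t - Re c)) has_real_derivative
        uxx p + 2 * \<epsilon>) (at 0)"
      using chain[of ux "uxx p" "uxy p" 0 1] u(2)[OF pb] by (auto intro!: derivative_eq_intros)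
  qed (rule maxx)
  moreover have "uyy p + 2 * \<epsilon> \<le> 0"
  proof (rule second_derivative_at_max[OF d(1), where f = "\<lambda>t. \<psi> (p + of_real t * \<i>)" and
        f' = "\<lambda>t. uy (p + of_real t * \<i>) + 2 * \<epsilon> * (Im p + t - Im c)"])
    show "((\<lambda>t. \<psi> (p + of_real t * \<i>)) has_real_derivative
        uy (p + of_real t * \<i>) + 2 * \<epsilon> * (Im p + t - Im c)) (at t)" if "\<bar>t\<bar> < d" for t
      unfolding \<psi>_def using chain[OF u(1)[OF inx(2)[OF that]]]
      by (auto intro!: derivative_eq_intros simp: algebra_simps)
    show "((\<lambda>t. uy (p + of_real t * \<i>) + 2 * \<epsilon> * (Im p + t - Im c)) has_real_derivative
        uyy p + 2 * \<epsilon>) (at 0)"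
      using chain[of uy "uyx p" "uyy p" 0 \<i>] u(3)[OF pb] by (auto intro!: derivative_eq_intros)
  qed (rule maxx)
  ultimately show False using u(4)[OF pb] \<epsilon>(1) by linarith
qed

lemma harmonic_on_imp_continuous_on:
  assumes "harmonic_on S v"
  shows "continuous_on S v"
proof -
  have "\<exists>f'. (v has_derivative f') (at p)" if "p \<in> S" for p
    using assms that unfolding harmonic_on_def by blast
  then show ?thesis
    by (meson continuous_at_imp_continuous_on has_derivative_continuous)
qed

text \<open>The Dirichlet solution with boundary values \<open>v\<close> is a real part by
  construction; the maximum principle for the difference, in both signs, identifies it with
  \<open>v\<close>.\<close>

lemma harmonic_on_UNIV_imp_Re:
  assumes v: "harmonic_on UNIV v" and r: "0 < r"
  obtains F where "F holomorphic_on ball c r" "\<And>x. x \<in> ball c r \<Longrightarrow> v x = Re (F x)"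
proof -
  have cv: "continuous_on T v" for T
    using harmonic_on_imp_continuous_on[OF v] continuous_on_subset by blast
  obtain u F where u: "continuous_on (cball c r) u" "\<And>x. x \<in> sphere c r \<Longrightarrow> u x = v x"
    and F: "F holomorphic_on ball c r" "\<And>x. x \<in> ball c r \<Longrightarrow> u x = Re (F x)"
    by (rule Dirichlet_disc[OF r cv]) blast
  have hv: "harmonic_on (ball c r) v" by (rule harmonic_on_subset[OF v]) auto
  have hF: "harmonic_on (ball c r) (\<lambda>x. Re (F x))" by (rule harmonic_on_Re[OF F(1)]) simp
  have vu: "v x - u x \<le> 0" if "x \<in> cball c r" for x
  proof (rule harmonic_max_principle[OF r _ _ _ that, where D = "\<lambda>x. v x - u x"])
    show "harmonic_on (ball c r) (\<lambda>x. v x - u x)"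
      by (rule harmonic_on_cong[OF harmonic_on_diff[OF hv hF]]) (use F in simp)
  qed (use u cv in \<open>auto intro!: continuous_intros\<close>)
  have uv: "u x - v x \<le> 0" if "x \<in> cball c r" for x
  proof (rule harmonic_max_principle[OF r _ _ _ that, where D = "\<lambda>x. u x - v x"])
    show "harmonic_on (ball c r) (\<lambda>x. u x - v x)"
      by (rule harmonic_on_cong[OF harmonic_on_diff[OF hF hv]]) (use F in simp)
  qed (use u cv in \<open>auto intro!: continuous_intros\<close>)
  show ?thesis
  proof (rule that[OF F(1)])
    show "v x = Re (F x)" if "x \<in> ball c r" for x
      using F(2)[OF that] vu[of x] uv[of x] that by simp
  qed
qed

text \<open>The functions \<open>F\<close> on different discs need not agree, since their imaginary
  parts are determined only up to constants. The partial derivatives are therefore defined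
  intrinsically by \<open>frechet_derivative\<close>, and each disc serves only to identify them
  there.\<close>

lemma harmonic_on_UNIV_if_Re:
  assumes "\<And>r. 0 < r \<Longrightarrow> \<exists>F. F holomorphic_on ball 0 r \<and> (\<forall>x\<in>ball 0 r. v x = Re (F x))"
  shows "harmonic_on UNIV v"
proof -
  define dx where "dx f p = frechet_derivative f (at p) (1::complex)" for f :: "complex \<Rightarrow> real" and p
  define dy where "dy f p = frechet_derivative f (at p) \<i>" for f :: "complex \<Rightarrow> real" and p
  \<comment> \<open>Applied to \<open>v\<close>, \<open>dx v\<close> and \<open>dy v\<close> in
    turn: the partial derivatives of a real part are again real parts of holomorphic
    functions.\<close>
  have key: "(f has_derivative (\<lambda>h. dx f p * Re h + dy f p * Im h)) (at p) \<and>
      dx f p = Re (deriv F p) \<and> dy f p = Re (\<i> * deriv F p)"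
    if F: "F holomorphic_on ball 0 r" "\<And>x. x \<in> ball 0 r \<Longrightarrow> f x = Re (F x)" and p: "p \<in> ball 0 r" for f F r p
  proof -
    have "((\<lambda>x. Re (F x)) has_derivative (\<lambda>h. Re (deriv F p) * Re h + Re (\<i> * deriv F p) * Im h)) (at p)"
      by (rule Re_has_derivative[OF F(1) open_ball p])
    then have *: "(f has_derivative (\<lambda>h. Re (deriv F p) * Re h + Re (\<i> * deriv F p) * Im h)) (at p)"
      using has_derivative_transform_within_open[OF _ open_ball p] F(2) by metis
    then have "frechet_derivative f (at p) = (\<lambda>h. Re (deriv F p) * Re h + Re (\<i> * deriv F p) * Im h)"
      by (rule frechet_derivative_at[symmetric])
    then show ?thesis using * by (simp add: dx_def dy_def)
  qed
  have all: "\<exists>F2. F2 holomorphic_on ball 0 r \<and> (\<forall>p\<in>ball 0 r.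
      (v has_derivative (\<lambda>h. dx v p * Re h + dy v p * Im h)) (at p) \<and>
      (dx v has_derivative (\<lambda>h. dx (dx v) p * Re h + dy (dx v) p * Im h)) (at p) \<and>
      (dy v has_derivative (\<lambda>h. dx (dy v) p * Re h + dy (dy v) p * Im h)) (at p) \<and>
      dx (dx v) p = Re (F2 p) \<and> dy (dx v) p = Re (\<i> * F2 p) \<and>
      dx (dy v) p = Re (\<i> * F2 p) \<and> dy (dy v) p = Re (\<i> * (\<i> * F2 p)))" if r: "0 < r" for r
  proof -
    obtain F where F: "F holomorphic_on ball 0 r" "\<And>x. x \<in> ball 0 r \<Longrightarrow> v x = Re (F x)"
      using assms[OF r] by blast
    have F1: "deriv F holomorphic_on ball 0 r" by (rule holomorphic_deriv[OF F(1)]) simp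
    have iF1: "(\<lambda>p. \<i> * deriv F p) holomorphic_on ball 0 r" by (intro holomorphic_intros F1)
    have d: "deriv (\<lambda>p. \<i> * deriv F p) p = \<i> * deriv (deriv F) p" if "p \<in> ball 0 r" for p
      using F1 that by (intro deriv_cmult) (metis holomorphic_on_imp_differentiable_at open_ball)
    have F2: "deriv (deriv F) holomorphic_on ball 0 r" by (rule holomorphic_deriv[OF F1]) simp
    have k0: "(v has_derivative (\<lambda>h. dx v p * Re h + dy v p * Im h)) (at p) \<and>
        dx v p = Re (deriv F p) \<and> dy v p = Re (\<i> * deriv F p)" if "p \<in> ball 0 r" for p
      by (rule key[OF F that])
    have kx: "(dx v has_derivative (\<lambda>h. dx (dx v) p * Re h + dy (dx v) p * Im h)) (at p) \<and>
        dx (dx v) p = Re (deriv (deriv F) p) \<and> dy (dx v) p = Re (\<i> * deriv (deriv F) p)"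
      if "p \<in> ball 0 r" for p
      by (rule key[OF F1 _ that]) (use k0 in blast)
    have ky: "(dy v has_derivative (\<lambda>h. dx (dy v) p * Re h + dy (dy v) p * Im h)) (at p) \<and>
        dx (dy v) p = Re (\<i> * deriv (deriv F) p) \<and> dy (dy v) p = Re (\<i> * (\<i> * deriv (deriv F) p))"
      if "p \<in> ball 0 r" for p
      unfolding d[OF that, symmetric] by (rule key[OF iF1 _ that]) (use k0 in blast)
    show ?thesis
    proof (intro exI[of _ "deriv (deriv F)"] conjI ballI F2)
      fix p :: complex assume p: "p \<in> ball 0 r"
      show "(v has_derivative (\<lambda>h. dx v p * Re h + dy v p * Im h)) (at p)" using k0[OF p] by blast
      show "(dx v has_derivative (\<lambda>h. dx (dx v) p * Re h + dy (dx v) p * Im h)) (at p)"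
        "dx (dx v) p = Re (deriv (deriv F) p)" "dy (dx v) p = Re (\<i> * deriv (deriv F) p)"
        using kx[OF p] by blast+
      show "(dy v has_derivative (\<lambda>h. dx (dy v) p * Re h + dy (dy v) p * Im h)) (at p)"
        "dx (dy v) p = Re (\<i> * deriv (deriv F) p)" "dy (dy v) p = Re (\<i> * (\<i> * deriv (deriv F) p))"
        using ky[OF p] by blast+
    qed
  qed
  have cont: "continuous_on UNIV g" if "\<And>r. 0 < r \<Longrightarrow> continuous_on (ball 0 r) g" for g :: "complex \<Rightarrow> real"
  proof -
    have "isCont g p" for p
    proof -
      have "0 < cmod p + 1" by (simp add: add_nonneg_pos)
      moreover have "p \<in> ball 0 (cmod p + 1)" by simp
      ultimately show ?thesis
        using that[of "cmod p + 1"] continuous_on_eq_continuous_at[OF open_ball] by blast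
    qed
    then show ?thesis by (simp add: continuous_at_imp_continuous_on)
  qed
  have at: "0 < cmod p + 1" "p \<in> ball 0 (cmod p + 1)" for p :: complex
    by (auto simp: add_nonneg_pos)
  show ?thesis
    unfolding harmonic_on_def
  proof (intro conjI exI ballI open_UNIV)
    fix p :: complex
    obtain F2 where F2: "\<forall>p\<in>ball 0 (cmod p + 1).
      (v has_derivative (\<lambda>h. dx v p * Re h + dy v p * Im h)) (at p) \<and>
      (dx v has_derivative (\<lambda>h. dx (dx v) p * Re h + dy (dx v) p * Im h)) (at p) \<and>
      (dy v has_derivative (\<lambda>h. dx (dy v) p * Re h + dy (dy v) p * Im h)) (at p) \<and>
      dx (dx v) p = Re (F2 p) \<and> dy (dx v) p = Re (\<i> * F2 p) \<and>
      dx (dy v) p = Re (\<i> * F2 p) \<and> dy (dy v) p = Re (\<i> * (\<i> * F2 p))"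
      using all[OF at(1)[of p]] by blast
    note * = bspec[OF F2 at(2)[of p]]
    show "(v has_derivative (\<lambda>h. dx v p * Re h + dy v p * Im h)) (at p)" using * by blast
    show "(dx v has_derivative (\<lambda>h. dx (dx v) p * Re h + dy (dx v) p * Im h)) (at p)" using * by blast
    show "(dy v has_derivative (\<lambda>h. dx (dy v) p * Re h + dy (dy v) p * Im h)) (at p)" using * by blast
    show "dx (dx v) p + dy (dy v) p = 0" using * by simp
  next
    have c: "continuous_on (ball 0 r) (dx (dx v)) \<and> continuous_on (ball 0 r) (dy (dx v)) \<and>
        continuous_on (ball 0 r) (dx (dy v)) \<and> continuous_on (ball 0 r) (dy (dy v))" if r: "0 < r" for r
    proof -
      obtain F2 where F2: "F2 holomorphic_on ball 0 r"
        "\<And>p. p \<in> ball 0 r \<Longrightarrow> dx (dx v) p = Re (F2 p)" "\<And>p. p \<in> ball 0 r \<Longrightarrow> dy (dx v) p = Re (\<i> * F2 p)"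
        "\<And>p. p \<in> ball 0 r \<Longrightarrow> dx (dy v) p = Re (\<i> * F2 p)" "\<And>p. p \<in> ball 0 r \<Longrightarrow> dy (dy v) p = Re (\<i> * (\<i> * F2 p))"
        using all[OF r] by blast
      have "continuous_on (ball 0 r) F2" using F2(1) by (rule holomorphic_on_imp_continuous_on)
      then have "continuous_on (ball 0 r) g" if "\<And>p. p \<in> ball 0 r \<Longrightarrow> g p = Re (k * F2 p)" for g k
        by (subst continuous_on_cong[OF refl that]) (auto intro!: continuous_intros)
      from this[of _ 1] this[of _ \<i>] this[of _ "\<i> * \<i>"] show ?thesis
        by (simp add: F2(2-))
    qed
    show "continuous_on UNIV (dx (dx v))" "continuous_on UNIV (dy (dx v))"
      "continuous_on UNIV (dx (dy v))" "continuous_on UNIV (dy (dy v))"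
      using c by (blast intro: cont)+
  qed
qed

section \<open>Local bounds for discs\<close>

text \<open>A test function above \<open>b\<close> that meets it at \<open>p\<close> also lies above
  \<open>\<beta>\<close> and meets it there. Contact makes it equal to \<open>\<beta>\<close> near
  \<open>p\<close>, and \<open>b\<close> is squeezed in between.\<close>

lemma subh_touching_below:
  assumes "open T" "subh T \<beta>" and le: "\<And>x. x \<in> T \<Longrightarrow> \<beta> x \<le> b x" and p: "p \<in> T" "\<beta> p = b p"
  shows "subh {p} b"
proof (rule subhI)
  fix q H and e :: real
  assume "q \<in> {p}" and e: "0 < e" and H: "H holomorphic_on ball q e"
    and Hle: "\<And>x. x \<in> ball q e \<Longrightarrow> b x \<le> Re (H x)" and eq: "b q = Re (H q)"
  then have q: "q = p" by simp
  obtain d where d: "d > 0" "ball p d \<subseteq> T" using assms(1) p(1) openE by blast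
  define r where "r = min d e"
  have r: "r > 0" "ball p r \<subseteq> T" "ball p r \<subseteq> ball q e" using d e by (auto simp: r_def q)
  have "\<forall>\<^sub>F x in nhds p. \<beta> x = Re (H x)"
  proof (rule subhD[OF assms(2) p(1) r(1) holomorphic_on_subset[OF H r(3)]])
    show "\<beta> x \<le> Re (H x)" if "x \<in> ball p r" for x
      using le[of x] Hle[of x] r that by force
  qed (use eq p q in simp)
  moreover have "\<forall>\<^sub>F x in nhds p. x \<in> ball p r"
    using r(1) by (intro eventually_nhds_in_open) auto
  ultimately have "\<forall>\<^sub>F x in nhds p. b x = Re (H x)"
  proof eventually_elim
    case (elim x)
    then show ?case using le[of x] Hle[of x] r by force
  qed
  then show "\<forall>\<^sub>F x in nhds q. b x = Re (H x)" using q by simp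
qed

theorem subh_logarithmic_minorant:
  assumes cv: "continuous_on UNIV v" and sub: "subh UNIV v" and non: "\<not> harmonic_on UNIV v"
  obtains b R \<delta> C where "0 < R" "0 < \<delta>" "continuous_on UNIV b" "subh UNIV b"
    "\<And>x. b x \<le> v x + C - \<delta> * ln (max 1 (cmod x / R))"
proof -
  have cvs: "continuous_on T v" for T using cv continuous_on_subset by blast
  obtain R where R: "0 < R" and noF: "\<nexists>F. F holomorphic_on ball 0 R \<and> (\<forall>x\<in>ball 0 R. v x = Re (F x))"
    using non harmonic_on_UNIV_if_Re by blast
  obtain u F where cu: "continuous_on (cball 0 R) u" and uv: "\<And>x. x \<in> sphere 0 R \<Longrightarrow> u x = v x"
    and F: "F holomorphic_on ball 0 R" and uF: "\<And>x. x \<in> ball 0 R \<Longrightarrow> u x = Re (F x)"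
    using Dirichlet_disc[OF R cvs] by metis
  have subD: "subh (ball 0 R) (\<lambda>x. v x - u x)"
    by (rule subh_cong[OF _ subh_add_Re[OF subh_subset[OF sub], where F = "\<lambda>x. - F x"]])
      (use uF in \<open>auto intro!: holomorphic_intros F\<close>)
  have cD: "continuous_on (cball 0 R) (\<lambda>x. v x - u x)" by (intro continuous_intros cu cvs)
  have le: "v x \<le> u x" if "x \<in> cball 0 R" for x
    using subh_max_principle[of "ball 0 R" "\<lambda>x. v x - u x" x] subD cD uv R that
    by (simp add: frontier_ball)
  \<comment> \<open>One point of equality would, by the strong maximum principle, make
    \<open>v\<close> the real part of \<open>F\<close> on the whole disc, which the choice of
    \<open>R\<close> excludes.\<close>
  have less: "v x < u x" if x: "x \<in> ball 0 R" for x
  proof (rule ccontr)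
    assume "\<not> v x < u x"
    then have "v x = Re (F x)" using le[of x] x uF[of x] by simp
    then have "v y = Re (F y)" if "y \<in> ball 0 R" for y
      using subh_strong_max_principle[OF open_ball connected_ball cvs subh_subset[OF sub] F _ x _ that]
        le uF by (metis ball_subset_cball subset_iff subset_UNIV)
    then show False using noF F by blast
  qed
  define \<rho> where "\<rho> = R / 2"
  have \<rho>: "0 < \<rho>" "\<rho> < R" using R by (auto simp: \<rho>_def)
  have "sphere (0::complex) \<rho> \<noteq> {}" using \<rho> by simp
  moreover have "continuous_on (sphere 0 \<rho>) (\<lambda>x. v x - u x)"
    by (rule continuous_on_subset[OF cD]) (use \<rho> in auto)
  ultimately obtain z where z: "z \<in> sphere 0 \<rho>" "\<And>y. y \<in> sphere 0 \<rho> \<Longrightarrow> v y - u y \<le> v z - u z"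
    using continuous_attains_sup[of "sphere 0 \<rho>" "\<lambda>x. v x - u x"] compact_sphere by blast
  \<comment> \<open>The smallest gap \<open>u - v\<close> on the circle of radius
    \<open>R / 2\<close>, divided by \<open>ln 2\<close>: there the logarithmic term raises
    \<open>v\<close> by exactly this gap, so that \<open>\<beta> \<le> u\<close> on both boundary
    circles of \<open>A\<close>.\<close>
  define \<delta> where "\<delta> = (u z - v z) / ln 2"
  have \<delta>: "0 < \<delta>" using less[of z] z(1) \<rho> by (simp add: \<delta>_def)
  define A where "A = ball 0 R - cball (0::complex) \<rho>"
  have oA: "open A" by (simp add: A_def open_Diff)
  have clA: "closure A \<subseteq> cball 0 R - ball 0 \<rho>"
    unfolding A_def by (rule closure_minimal) (auto simp: closed_Diff)
  define \<beta> where "\<beta> x = v x + (- \<delta>) * ln (dist 0 x / R)" for x :: complex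
  \<comment> \<open>A Hopf-type estimate: the strict inequality inside forces a definite gap near the circle.\<close>
  have ann: "\<beta> x \<le> u x" if x: "x \<in> A" for x
  proof -
    have "\<beta> x - u x \<le> 0"
    proof (rule subh_max_principle[where v = "\<lambda>x. \<beta> x - u x", OF oA])
      show "bounded A" unfolding A_def by (rule bounded_subset[of "ball 0 R"]) auto
      have "subh A (\<lambda>x. (v x - u x) + (- \<delta>) * ln (dist 0 x / R))"
        by (rule subh_add_ln[OF oA subh_subset[OF subD] _ R]) (use \<rho> in \<open>auto simp: A_def\<close>)
      then show "subh A (\<lambda>x. \<beta> x - u x)" unfolding \<beta>_def by (simp add: algebra_simps)
      have "continuous_on (cball 0 R - ball 0 \<rho>) (\<lambda>x. \<beta> x - u x)"
        unfolding \<beta>_def using \<rho> R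
        by (intro continuous_intros continuous_on_subset[OF cu] cvs) auto
      then show "continuous_on (closure A) (\<lambda>x. \<beta> x - u x)" using clA continuous_on_subset by blast
      show "x \<in> closure A" using x closure_subset by blast
      show "\<beta> y - u y \<le> 0" if y: "y \<in> frontier A" for y
      proof -
        have y': "y \<in> cball 0 R - ball 0 \<rho>" "y \<notin> A"
          using y clA oA by (auto simp: frontier_def interior_open)
        then consider "cmod y = R" | "cmod y = \<rho>" unfolding A_def by force
        then show ?thesis
        proof cases
          case 1
          then show ?thesis using uv[of y] R by (simp add: \<beta>_def)
        next
          case 2
          have "ln (\<rho> / R) = - ln 2" using R by (simp add: \<rho>_def ln_div ln_mult)
          then have "\<beta> y - u y = v y - u y + (u z - v z)" using 2 by (simp add: \<beta>_def \<delta>_def)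
          then show ?thesis using z(2)[of y] 2 by simp
        qed
      qed
    qed
    then show ?thesis by simp
  qed
  \<comment> \<open>Both pieces equal \<open>v\<close> on the circle, where the logarithm vanishes.
    By \<open>ann\<close>, \<open>\<beta>\<close> stays below \<open>b\<close> on both sides of it,
    so \<open>\<beta>\<close> touches \<open>b\<close> from below at every point of the
    circle.\<close>
  define b where "b x = (if cmod x \<le> R then u x else \<beta> x)" for x
  have out: "b x = \<beta> x" if "R \<le> cmod x" for x
    using that uv[of x] R by (auto simp: b_def \<beta>_def)
  have c\<beta>: "continuous_on (- {0}) \<beta>"
    unfolding \<beta>_def using R by (intro continuous_intros cvs) auto
  have cb: "continuous_on UNIV b"
    unfolding b_def
  proof (rule continuous_on_cases_le)
    show "continuous_on {t \<in> UNIV. cmod t \<le> R} u"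
      by (rule continuous_on_subset[OF cu]) auto
    show "continuous_on {t \<in> UNIV. R \<le> cmod t} \<beta>"
      by (rule continuous_on_subset[OF c\<beta>]) (use R in auto)
    show "u t = \<beta> t" if "cmod t = R" for t
      using out[of t] that by (simp add: b_def)
  qed (intro continuous_intros)
  have s\<beta>: "subh (- {0}) \<beta>"
    unfolding \<beta>_def by (rule subh_add_ln[OF _ subh_subset[OF sub] _ R]) auto
  have sb: "subh UNIV b"
  proof (rule subh_local)
    fix p :: complex
    consider "cmod p < R" | "cmod p > R" | "cmod p = R" by linarith
    then show "\<exists>T. p \<in> T \<and> subh T b"
    proof cases
      case 1
      have "subh (ball 0 R) b"
        by (rule subh_cong[OF _ subh_Re[OF _ F]]) (use uF in \<open>auto simp: b_def\<close>)
      then show ?thesis using 1 by (intro exI[of _ "ball 0 R"]) auto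
    next
      case 2
      have "subh (- cball 0 R) b"
        by (rule subh_cong[OF _ subh_subset[OF s\<beta>]]) (use out R in auto)
      then show ?thesis using 2 by (intro exI[of _ "- cball 0 R"]) auto
    next
      case 3
      have "subh {p} b"
      proof (rule subh_touching_below[of "- cball 0 \<rho>" \<beta>])
        show "subh (- cball 0 \<rho>) \<beta>" by (rule subh_subset[OF s\<beta>]) (use \<rho> in auto)
        show "\<beta> x \<le> b x" if "x \<in> - cball 0 \<rho>" for x
          using ann[of x] out[of x] that by (cases "cmod x < R") (auto simp: b_def A_def)
        show "\<beta> p = b p" using out[of p] 3 by simp
        show "p \<in> - cball 0 \<rho>" using 3 \<rho> by simp
      qed auto
      then show ?thesis by blast
    qed
  qed
  obtain C where C: "\<And>x. x \<in> cball 0 R \<Longrightarrow> \<bar>v x - u x\<bar> \<le> C"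
  proof -
    have "bounded ((\<lambda>x. v x - u x) ` cball 0 R)"
      by (intro compact_imp_bounded compact_continuous_image[OF cD]) simp
    then show ?thesis using that unfolding bounded_iff real_norm_def by (metis imageI)
  qed
  have C0: "C \<ge> 0" using C[of 0] R by (simp add: order_trans[OF abs_ge_zero])
  show ?thesis
  proof (rule that[OF R \<delta> cb sb])
    show "b x \<le> v x + C - \<delta> * ln (max 1 (cmod x / R))" for x
    proof (cases "cmod x \<le> R")
      case True
      then have "max 1 (cmod x / R) = 1" using R by (simp add: max_def divide_simps)
      then show ?thesis using C[of x] True by (simp add: b_def abs_le_iff)
    next
      case False
      then have "max 1 (cmod x / R) = cmod x / R" using R by (simp add: max_def divide_simps)
      then show ?thesis using False C0 by (simp add: b_def \<beta>_def)
    qed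
  qed
qed

text \<open>The bound has to serve all discs meeting \<open>L\<close> at once, so every constant is
  fixed before \<open>z\<close> and \<open>w\<close> appear. The order is forced:
  \<open>Im z\<close> has a lower bound only once \<open>w\<close> is confined to a compact set, and
  only then can Harnack's inequality be applied to \<open>z\<close>.\<close>

lemma hol_disc_locally_bounded:
  assumes cv: "continuous_on UNIV v" and sub: "subh UNIV v" and non: "\<not> harmonic_on UNIV v"
    and L: "compact L" and t: "0 \<le> t" "t < 1"
  obtains M where "\<And>z w x y. \<lbrakk>z holomorphic_on ball 0 1; w holomorphic_on ball 0 1;
      \<And>\<zeta>. \<zeta> \<in> ball 0 1 \<Longrightarrow> v (w \<zeta>) \<le> Im (z \<zeta>); x \<in> cball 0 t; (z x, w x) \<in> L; y \<in> cball 0 t\<rbrakk>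
      \<Longrightarrow> cmod (z y) \<le> M \<and> cmod (w y) \<le> M"
proof -
  obtain b R \<delta> C where R: "0 < R" and \<delta>: "0 < \<delta>" and cb: "continuous_on UNIV b" and sb: "subh UNIV b"
    and b: "\<And>x. b x \<le> v x + C - \<delta> * ln (max 1 (cmod x / R))"
    using subh_logarithmic_minorant[OF cv sub non] by metis
  \<comment> \<open>Harnack's inequality is used twice, each time shrinking the radius by the factor
    \<open>s\<close>: from \<open>s\<close> to \<open>s^2\<close> for \<open>w\<close>, and from
    \<open>s^2\<close> to \<open>s^3\<close> for \<open>z\<close>. The last radius still has to be
    at least \<open>t\<close>.\<close>
  define s where "s = root 3 ((1 + t) / 2)"
  have s: "0 < s" "s < 1" "t \<le> s ^ 3"
    using t by (auto simp: s_def real_root_pow_pos2)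
  have ss: "s ^ 3 = s * s\<^sup>2" "s\<^sup>2 = s * s" by (simp_all add: power2_eq_square power3_eq_cube)
  have "s * (s * s) \<le> 1 * (s * s)" using s by (intro mult_right_mono) auto
  then have tr: "t \<le> s * s" "t \<le> s * s\<^sup>2" using s(3) unfolding ss by linarith+
  define \<kappa> where "\<kappa> = ((1 + s) / (1 - s))\<^sup>2"
  have \<kappa>: "0 \<le> \<kappa>" by (simp add: \<kappa>_def)
  have cont: "continuous_on L (\<lambda>p. Im (fst p) - b (snd p))"
    by (intro continuous_intros continuous_on_compose2[OF cb]) auto
  obtain N where N: "\<And>p. p \<in> L \<Longrightarrow> Im (fst p) - b (snd p) \<le> N"
  proof -
    have "bounded ((\<lambda>p. Im (fst p) - b (snd p)) ` L)"
      by (intro compact_imp_bounded compact_continuous_image[OF cont] L)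
    then show ?thesis using that unfolding bounded_iff real_norm_def by (metis imageI abs_le_D1)
  qed
  obtain N1 where N1: "\<And>p. p \<in> L \<Longrightarrow> cmod (fst p) \<le> N1"
  proof -
    have "bounded (fst ` L)"
      by (intro compact_imp_bounded compact_continuous_image continuous_intros L)
    then show ?thesis using that unfolding bounded_iff by (metis imageI)
  qed
  define T where "T = \<kappa> * ((N + C) / \<delta> + 2)"
  define Mw where "Mw = R * exp T"
  obtain M1 where M1: "\<And>x. x \<in> cball 0 Mw \<Longrightarrow> \<bar>v x\<bar> \<le> M1"
  proof -
    have "bounded (v ` cball 0 Mw)"
      by (intro compact_imp_bounded compact_continuous_image continuous_on_subset[OF cv]) auto
    then show ?thesis using that unfolding bounded_iff real_norm_def by (metis imageI)
  qed
  define Mz where "Mz = \<kappa> * (N1 + \<bar>M1\<bar> + 1) + \<bar>M1\<bar> + 1"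
  show ?thesis
  proof (rule that[of "max Mz Mw"])
    fix z w and x y :: complex
    assume hz: "z holomorphic_on ball 0 1" and hw: "w holomorphic_on ball 0 1"
      and le: "\<And>\<zeta>. \<zeta> \<in> ball 0 1 \<Longrightarrow> v (w \<zeta>) \<le> Im (z \<zeta>)"
      and x: "x \<in> cball 0 t" and xL: "(z x, w x) \<in> L" and y: "y \<in> cball 0 t"
    have sb1: "cball 0 s \<subseteq> ball (0::complex) 1" "ball 0 s \<subseteq> ball (0::complex) 1" using s by auto
    have hzs: "z holomorphic_on ball 0 s" and hws: "w holomorphic_on ball 0 s"
      using hz hw sb1(2) holomorphic_on_subset by blast+
    have cz: "continuous_on (cball 0 s) z" and cw: "continuous_on (cball 0 s) w"
      using hz hw sb1(1) holomorphic_on_imp_continuous_on continuous_on_subset by blast+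
    define \<Lambda> where "\<Lambda> \<zeta> = ln (max 1 (cmod (w \<zeta>) / R))" for \<zeta>
    \<comment> \<open>Approximating \<open>\<Lambda> + 3/2\<close> up to \<open>1/2\<close> puts
      \<open>Re H\<close> between \<open>\<Lambda> + 1\<close> and \<open>\<Lambda> + 2\<close> on
      the circle: a majorant, positive, and off by a bounded amount only.\<close>
    have c\<Lambda>: "continuous_on (sphere 0 s) (\<lambda>\<zeta>. \<Lambda> \<zeta> + 3/2)"
      unfolding \<Lambda>_def using R
      by (intro continuous_intros continuous_on_subset[OF cw]) (auto simp: max_def)
    obtain H where H: "H holomorphic_on UNIV" "\<And>\<zeta>. \<zeta> \<in> sphere 0 s \<Longrightarrow> \<bar>\<Lambda> \<zeta> + 3/2 - Re (H \<zeta>)\<bar> < 1/2"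
      using Re_entire_approx_on_sphere[OF s(1) c\<Lambda>, of "1/2"] by auto
    have Hon: "H holomorphic_on U" for U using H(1) holomorphic_on_subset by blast
    have Hc: "continuous_on U H" for U using Hon holomorphic_on_imp_continuous_on by blast
    have \<Lambda>0: "\<Lambda> \<zeta> \<ge> 0" for \<zeta> by (simp add: \<Lambda>_def)
    have Hb: "\<Lambda> \<zeta> + 1 \<le> Re (H \<zeta>)" "Re (H \<zeta>) \<le> \<Lambda> \<zeta> + 2" if "\<zeta> \<in> sphere 0 s" for \<zeta>
      using H(2)[OF that] by linarith+
    have Hpos: "0 < Re (H \<zeta>)" if "\<zeta> \<in> cball 0 s" for \<zeta>
    proof -
      have "Re 1 \<le> Re (H \<zeta>)"
      proof (rule subh_le_Re_cball[OF s(1) _ _ _ _ _ that, where v = "\<lambda>_. Re 1"])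
        show "subh (ball 0 s) (\<lambda>_. Re 1)" by (rule subh_Re) auto
        show "Re 1 \<le> Re (H \<xi>)" if "\<xi> \<in> sphere 0 s" for \<xi> using Hb(1)[OF that] \<Lambda>0[of \<xi>] by simp
      qed (auto intro!: Hon Hc)
      then show ?thesis by simp
    qed
    have xs: "cmod x \<le> s * s" "cmod x \<le> s * s\<^sup>2" "cmod y \<le> s * s" "cmod y \<le> s * s\<^sup>2"
      using x y tr by auto
    have "s * s \<le> s" using s by (simp add: mult_left_le)
    then have xy: "x \<in> cball 0 s" "y \<in> cball 0 s" using xs by auto
    \<comment> \<open>On the circle the gap between \<open>b\<close> and \<open>v\<close> pays for
      \<open>\<delta> * Re (H \<zeta>)\<close>. The maximum principle carries the inequality to
      \<open>x\<close>, where \<open>Im (z x) - b (w x) \<le> N\<close> because the point lies in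
      \<open>L\<close>.\<close>
    have "b (w x) \<le> Re (- \<i> * z x + of_real (C + 2 * \<delta>) - of_real \<delta> * H x)"
    proof (rule subh_le_Re_cball[OF s(1) _ _ _ _ _ xy(1), where v = "\<lambda>\<zeta>. b (w \<zeta>)" and
          H = "\<lambda>\<zeta>. - \<i> * z \<zeta> + of_real (C + 2 * \<delta>) - of_real \<delta> * H \<zeta>"])
      show "subh (ball 0 s) (\<lambda>\<zeta>. b (w \<zeta>))"
        by (rule subh_compose[OF open_UNIV cb sb open_ball hws]) simp
      show "continuous_on (cball 0 s) (\<lambda>\<zeta>. b (w \<zeta>))"
        by (rule continuous_on_compose2[OF cb cw]) simp
      show "b (w \<zeta>) \<le> Re (- \<i> * z \<zeta> + of_real (C + 2 * \<delta>) - of_real \<delta> * H \<zeta>)" if "\<zeta> \<in> sphere 0 s" for \<zeta>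
      proof -
        have "\<zeta> \<in> ball 0 1" using that s by simp
        then have "b (w \<zeta>) \<le> Im (z \<zeta>) + C - \<delta> * \<Lambda> \<zeta>"
          using b[of "w \<zeta>"] le[of \<zeta>] by (simp add: \<Lambda>_def)
        moreover have "\<delta> * Re (H \<zeta>) \<le> \<delta> * (\<Lambda> \<zeta> + 2)"
          using Hb(2)[OF that] \<delta> by (intro mult_left_mono) auto
        ultimately show ?thesis by (simp add: algebra_simps)
      qed
    qed (auto intro!: continuous_intros holomorphic_intros Hon Hc cz hzs)
    then have "\<delta> * Re (H x) \<le> N + C + 2 * \<delta>"
      using N[OF xL] by simp
    then have Hx: "Re (H x) \<le> (N + C) / \<delta> + 2"
      using \<delta> by (simp add: field_simps)
    have ReH: "Re (H \<zeta>) \<le> T" if "cmod \<zeta> \<le> s * s" for \<zeta>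
    proof -
      \<comment> \<open>Harnack's inequality is about moduli; after subtracting the imaginary
        constant the modulus at \<open>x\<close> is just \<open>Re (H x)\<close>.\<close>
      have "cmod (H \<zeta> - \<i> * of_real (Im (H x))) \<le> \<kappa> * cmod (H x - \<i> * of_real (Im (H x)))"
        unfolding \<kappa>_def
        by (rule Harnack_Re_pos[OF s(1) _ _ s(2) xs(1) that, where H = "\<lambda>\<zeta>. H \<zeta> - \<i> * of_real (Im (H x))"])
          (use Hpos in \<open>auto intro!: holomorphic_intros Hon\<close>)
      also have "H x - \<i> * of_real (Im (H x)) = of_real (Re (H x))"
        by (simp add: complex_eq_iff)
      also have "\<kappa> * cmod (of_real (Re (H x))) \<le> T"
        unfolding T_def using Hx Hpos[OF xy(1)] \<kappa> by (intro mult_left_mono) auto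
      finally show ?thesis
        using complex_Re_le_cmod[of "H \<zeta> - \<i> * of_real (Im (H x))"] by simp
    qed
    \<comment> \<open>Maximum modulus for \<open>w * exp (- H)\<close>, whose modulus on the circle
      is at most \<open>R\<close> because \<open>Re H\<close> majorises
      \<open>\<Lambda>\<close>.\<close>
    have wle: "cmod (w \<zeta>) \<le> R * exp (Re (H \<zeta>))" if "\<zeta> \<in> cball 0 s" for \<zeta>
    proof -
      have "cmod (w \<zeta> * exp (- H \<zeta>)) \<le> R"
      proof (rule maximum_modulus_frontier[where S = "cball 0 s" and f = "\<lambda>\<zeta>. w \<zeta> * exp (- H \<zeta>)"])
        show "cmod (w \<xi> * exp (- H \<xi>)) \<le> R" if "\<xi> \<in> frontier (cball 0 s)" for \<xi>
        proof -
          have \<xi>: "\<xi> \<in> sphere 0 s" using that s by (simp add: frontier_cball)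
          have "cmod (w \<xi>) / R \<le> max 1 (cmod (w \<xi>) / R)" by simp
          also have "\<dots> = exp (\<Lambda> \<xi>)" by (simp add: \<Lambda>_def)
          also have "\<dots> \<le> exp (Re (H \<xi>))" using Hb(1)[OF \<xi>] by simp
          finally show ?thesis using R by (simp add: norm_divide exp_minus divide_simps mult.commute)
        qed
        show "(\<lambda>\<zeta>. w \<zeta> * exp (- H \<zeta>)) holomorphic_on interior (cball 0 s)"
          by (auto intro!: holomorphic_intros hws Hon)
        show "continuous_on (closure (cball 0 s)) (\<lambda>\<zeta>. w \<zeta> * exp (- H \<zeta>))"
          by (auto intro!: continuous_intros cw Hc)
      qed (use that in auto)
      then show ?thesis by (simp add: norm_divide exp_minus divide_simps mult.commute)
    qed
    have wM: "cmod (w \<zeta>) \<le> Mw" if "cmod \<zeta> \<le> s * s" for \<zeta>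
    proof -
      have "cmod (w \<zeta>) \<le> R * exp (Re (H \<zeta>))"
        using that \<open>s * s \<le> s\<close> by (intro wle) auto
      also have "\<dots> \<le> Mw" unfolding Mw_def using ReH[OF that] R by simp
      finally show ?thesis .
    qed
    \<comment> \<open>On the disc where \<open>cmod (w \<zeta>) \<le> Mw\<close>,
      \<open>Im z\<close> is at least \<open>- \<bar>M1\<bar>\<close>; the shift makes the real part
      of \<open>Z\<close> at least 1.\<close>
    define Z where "Z \<zeta> = - \<i> * z \<zeta> + of_real (\<bar>M1\<bar> + 1)" for \<zeta>
    have s2: "ball (0::complex) (s\<^sup>2) \<subseteq> ball 0 s"
      unfolding ss(2) using \<open>s * s \<le> s\<close> by (rule subset_ball)
    have "cmod (Z y) \<le> \<kappa> * cmod (Z x)"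
      unfolding \<kappa>_def
    proof (rule Harnack_Re_pos[OF _ _ _ s(2) xs(2,4)])
      show "Z holomorphic_on ball 0 (s\<^sup>2)"
        unfolding Z_def by (intro holomorphic_intros holomorphic_on_subset[OF hzs s2])
      show "0 < Re (Z \<zeta>)" if "\<zeta> \<in> ball 0 (s\<^sup>2)" for \<zeta>
      proof -
        have "cmod \<zeta> \<le> s * s" using that by (simp add: ss(2))
        then have "- \<bar>M1\<bar> \<le> v (w \<zeta>)" using M1[of "w \<zeta>"] wM[of \<zeta>] by auto
        also have "v (w \<zeta>) \<le> Im (z \<zeta>)" using that s2 sb1(2) by (intro le) blast
        finally show ?thesis by (simp add: Z_def)
      qed
    qed (use s in simp)
    also have "cmod (Z x) \<le> N1 + \<bar>M1\<bar> + 1"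
      using norm_triangle_ineq[of "- \<i> * z x" "of_real (\<bar>M1\<bar> + 1)"] N1[OF xL]
      by (simp add: Z_def norm_mult)
    then have "\<kappa> * cmod (Z x) \<le> \<kappa> * (N1 + \<bar>M1\<bar> + 1)" using \<kappa> by (rule mult_left_mono)
    finally have Zy: "cmod (Z y) \<le> \<kappa> * (N1 + \<bar>M1\<bar> + 1)" .
    have "cmod (z y) = cmod (Z y - of_real (\<bar>M1\<bar> + 1))" by (simp add: Z_def norm_mult)
    also have "\<dots> \<le> cmod (Z y) + (\<bar>M1\<bar> + 1)"
      using norm_triangle_ineq4[of "Z y" "of_real (\<bar>M1\<bar> + 1)"] by simp
    finally have "cmod (z y) \<le> Mz" using Zy by (simp add: Mz_def)
    then show "cmod (z y) \<le> max Mz Mw \<and> cmod (w y) \<le> max Mz Mw"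
      using wM[OF xs(3)] by auto
  qed
qed

section \<open>Tautness\<close>

lemma taut_convergent_subsequence:
  assumes X: "taut X" and f: "\<And>n. f n \<in> hol_discs X"
    and q: "q \<in> X" "\<omega> \<in> ball 0 1" "(\<lambda>n. f n \<omega>) \<longlonglongrightarrow> q"
  obtains \<rho> h where "strict_mono \<rho>" "h \<in> hol_discs X"
    "\<And>\<zeta>. \<zeta> \<in> ball 0 1 \<Longrightarrow> (\<lambda>n. f (\<rho> n) \<zeta>) \<longlonglongrightarrow> h \<zeta>"
proof -
  obtain \<rho> where \<rho>: "strict_mono \<rho>" "converges_in_discs X (f \<circ> \<rho>) \<or> compactly_divergent X (f \<circ> \<rho>)"
    using X f unfolding taut_def by blast
  have "open X" using X by (simp add: taut_def)
  then obtain e where e: "e > 0" "cball q e \<subseteq> X" using q(1) open_contains_cball by blast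
  \<comment> \<open>The compact sets \<open>{\<omega>}\<close> and \<open>cball q e\<close> witness
    this, since the values at \<open>\<omega>\<close> converge to \<open>q\<close>.\<close>
  have "\<not> compactly_divergent X (f \<circ> \<rho>)"
  proof
    assume "compactly_divergent X (f \<circ> \<rho>)"
    then have "\<forall>\<^sub>F n in sequentially. (f \<circ> \<rho>) n ` {\<omega>} \<inter> cball q e = {}"
      unfolding compactly_divergent_def using q(2) e(2) compact_cball[of q e] finite_imp_compact[of "{\<omega>}"]
      by blast
    moreover have "\<forall>\<^sub>F n in sequentially. f (\<rho> n) \<omega> \<in> ball q e"
      using LIMSEQ_subseq_LIMSEQ[OF q(3) \<rho>(1)] e(1)
      by (intro topological_tendstoD) (auto simp: o_def)
    ultimately have "\<forall>\<^sub>F n in sequentially. False"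
      by eventually_elim auto
    then show False by simp
  qed
  then obtain h where h: "h \<in> hol_discs X"
    "\<And>K. compact K \<Longrightarrow> K \<subseteq> ball 0 1 \<Longrightarrow> uniform_limit K (f \<circ> \<rho>) h sequentially"
    using \<rho>(2) unfolding converges_in_discs_def by blast
  have "(\<lambda>n. f (\<rho> n) \<zeta>) \<longlonglongrightarrow> h \<zeta>" if "\<zeta> \<in> ball 0 1" for \<zeta>
    using tendsto_uniform_limitI[OF h(2)[of "{\<zeta>}"], of \<zeta>] that by simp
  then show ?thesis using that \<rho>(1) h(1) by blast
qed

text \<open>The source of all contradictions by touching discs: a limit of discs with one value in
  \<open>X\<close> cannot have another value on the boundary.\<close>

lemma taut_pointwise_limit:
  assumes "taut X" "\<And>n. f n \<in> hol_discs X"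
    and "\<omega> \<in> ball 0 1" "g \<omega> \<in> X" and g: "\<And>\<zeta>. \<zeta> \<in> ball 0 1 \<Longrightarrow> (\<lambda>n. f n \<zeta>) \<longlonglongrightarrow> g \<zeta>"
    and \<zeta>: "\<zeta> \<in> ball 0 1"
  shows "g \<zeta> \<in> X"
proof -
  obtain \<rho> h where \<rho>: "strict_mono \<rho>" "h \<in> hol_discs X"
    "\<And>\<zeta>. \<zeta> \<in> ball 0 1 \<Longrightarrow> (\<lambda>n. f (\<rho> n) \<zeta>) \<longlonglongrightarrow> h \<zeta>"
    using taut_convergent_subsequence[OF assms(1,2,4,3) g[OF assms(3)]] by blast
  have "(\<lambda>n. f (\<rho> n) \<zeta>) \<longlonglongrightarrow> g \<zeta>"
    using LIMSEQ_subseq_LIMSEQ[OF g[OF \<zeta>] \<rho>(1)] by (simp add: o_def)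
  then have "g \<zeta> = h \<zeta>" using \<rho>(3)[OF \<zeta>] LIMSEQ_unique by blast
  then show ?thesis using \<rho>(2) \<zeta> by (auto simp: hol_discs_def)
qed

lemma taut_not_unbounded:
  assumes "taut X" "\<And>n. f n \<in> hol_discs X" and p: "\<And>n. f n 0 = p"
    and lim: "filterlim (\<lambda>n. norm (f n (1/2))) at_top sequentially"
  shows False
proof -
  have "p \<in> X" using assms(2)[of 0] p[of 0] by (auto simp: hol_discs_def image_subset_iff)
  moreover have "(0::complex) \<in> ball 0 1" "(\<lambda>n. f n 0) \<longlonglongrightarrow> p" using p by auto
  ultimately obtain \<rho> h where \<rho>: "strict_mono \<rho>"
    "\<And>\<zeta>. \<zeta> \<in> ball 0 1 \<Longrightarrow> (\<lambda>n. f (\<rho> n) \<zeta>) \<longlonglongrightarrow> h \<zeta>"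
    by (rule taut_convergent_subsequence[OF assms(1,2)]) blast
  have "(\<lambda>n. norm (f (\<rho> n) (1/2))) \<longlonglongrightarrow> norm (h (1/2))"
    by (intro tendsto_norm \<rho>(2)) simp
  moreover have "filterlim (\<lambda>n. norm (f (\<rho> n) (1/2))) at_top sequentially"
    using filterlim_compose[OF lim filterlim_subseq[OF \<rho>(1)]] .
  ultimately show False
    using not_tendsto_and_filterlim_at_infinity[OF sequentially_bot] filterlim_at_top_imp_at_infinity by blast
qed

text \<open>Over a point of value \<open>-\<infinity>\<close> the domain contains an entire complex
  line, and the discs \<open>n \<zeta>\<close> in it blow up.\<close>

lemma taut_Omega_imp_not_MInfty:
  assumes "taut (Omega a)"
  shows "a w \<noteq> -\<infinity>"
proof
  assume a: "a w = -\<infinity>"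
  let ?f = "\<lambda>n \<zeta>. (of_nat n * \<zeta>, w) :: complex \<times> complex"
  have "?f n \<in> hol_discs (Omega a)" for n
    by (auto simp: hol_discs_def Omega_def a intro!: holomorphic_intros)
  moreover have "filterlim (\<lambda>n. norm (?f n (1/2))) at_top sequentially"
  proof (rule filterlim_at_top_mono)
    show "filterlim (\<lambda>n. real n * (1/2)) at_top sequentially"
      by (rule filterlim_at_top_mult_tendsto_pos[OF tendsto_const _ filterlim_real_sequentially]) simp
    have "norm (of_nat n * (1/2) :: complex) \<le> norm (?f n (1/2))" for n
      using norm_fst_le[of "of_nat n * (1/2) :: complex" w] by simp
    then show "\<forall>\<^sub>F n in sequentially. real n * (1/2) \<le> norm (?f n (1/2))"
      by (simp add: norm_mult)
  qed
  ultimately show False using taut_not_unbounded[OF assms, of ?f "(0, w)"] by simp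
qed

text \<open>Lower semicontinuity is the issue. If \<open>v \<le> t < v w0\<close> at points
  \<open>w n\<close> tending to \<open>w0\<close>, one and the same disc in the \<open>z\<close>
  direction fits over all \<open>w n\<close>, but over \<open>w0\<close> it would leave the
  domain.\<close>

lemma taut_Omega_imp_continuous:
  fixes v :: "complex \<Rightarrow> real"
  assumes X: "taut (Omega (\<lambda>w. ereal (v w)))" and usc: "usc_on UNIV (\<lambda>w. ereal (v w))"
  shows "continuous_on UNIV v"
  unfolding continuous_on_def
proof (intro ballI order_tendstoI)
  fix w0 t assume "v w0 < t"
  then show "\<forall>\<^sub>F w in at w0. v w < t"
    using usc[unfolded usc_on_def, rule_format, of w0 "ereal t"] by simp
next
  fix w0 t assume t: "t < v w0"
  show "\<forall>\<^sub>F w in at w0. t < v w"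
  proof (rule ccontr)
    assume not: "\<not> ?thesis"
    have "\<exists>w. v w \<le> t \<and> dist w w0 < inverse (real (Suc n))" for n
      using not unfolding eventually_at by (auto simp: not_less dest!: spec[of _ "inverse (real (Suc n))"])
    then obtain w where w: "\<And>n. v (w n) \<le> t" "\<And>n. dist (w n) w0 < inverse (real (Suc n))"
      by metis
    have wlim: "w \<longlonglongrightarrow> w0"
      by (rule metric_LIMSEQ_I) (metis w(2) reals_Archimedean less_trans le_less_trans le_imp_inverse_le of_nat_0_less_iff zero_less_Suc of_nat_le_iff Suc_le_mono)
    define k where "k = v w0 - t"
    have k: "k > 0" using t by (simp add: k_def)
    \<comment> \<open>A disc in the half plane \<open>Im z > t\<close> that crosses the level \<open>Im z = v w0\<close> at the origin.\<close>
    define \<phi> where "\<phi> \<zeta> = \<i> * (of_real t + of_real k * (1 + \<zeta>))" for \<zeta>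
    have \<phi>: "Im (\<phi> \<zeta>) = t + k * (1 + Re \<zeta>)" for \<zeta> by (simp add: \<phi>_def)
    have "(\<phi> 0, w0) \<in> Omega (\<lambda>w. ereal (v w))"
    \<comment> \<open>At \<open>1/2\<close> the height is \<open>t + 3/2 * k\<close>, above
      \<open>v w0 = t + k\<close>; at 0 it is exactly \<open>v w0\<close>.\<close>
    proof (rule taut_pointwise_limit[OF X, where f = "\<lambda>n \<zeta>. (\<phi> \<zeta>, w n)" and g = "\<lambda>\<zeta>. (\<phi> \<zeta>, w0)" and \<omega> = "1/2"])
      show "(\<lambda>\<zeta>. (\<phi> \<zeta>, w n)) \<in> hol_discs (Omega (\<lambda>w. ereal (v w)))" for n
      proof -
        have "v (w n) < Im (\<phi> \<zeta>)" if "\<zeta> \<in> ball 0 1" for \<zeta>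
        proof -
          have "0 < 1 + Re \<zeta>" using that abs_Re_le_cmod[of \<zeta>] by auto
          then have "0 < k * (1 + Re \<zeta>)" using k by simp
          then show ?thesis using w(1)[of n] unfolding \<phi> by linarith
        qed
        then show ?thesis
          by (auto simp: hol_discs_def Omega_def \<phi>_def[abs_def] simp del: Im_complex_of_real intro!: holomorphic_intros)
      qed
      show "(\<phi> (1/2), w0) \<in> Omega (\<lambda>w. ereal (v w))"
        using k by (simp add: Omega_def \<phi>) (simp add: k_def field_simps)
    qed (auto intro!: tendsto_intros wlim)
    then show False by (simp add: Omega_def \<phi> k_def)
  qed
qed

lemma taut_Omega_imp_subh:
  fixes v :: "complex \<Rightarrow> real"
  assumes X: "taut (Omega (\<lambda>w. ereal (v w)))"
  shows "subh UNIV v"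
proof (rule subhI)
  fix p H and e :: real
  assume e: "0 < e" and H: "H holomorphic_on ball p e"
    and le: "\<And>x. x \<in> ball p e \<Longrightarrow> v x \<le> Re (H x)" and eq: "v p = Re (H p)"
  have inb: "p + of_real e * \<zeta> \<in> ball p e" if "\<zeta> \<in> ball 0 1" for \<zeta>
    using that e by (simp add: dist_norm norm_mult)
  have holH: "(\<lambda>\<zeta>. H (p + of_real e * \<zeta>)) holomorphic_on ball 0 1"
  proof -
    have "H \<circ> (\<lambda>\<zeta>. p + of_real e * \<zeta>) holomorphic_on ball 0 1"
      by (rule holomorphic_on_compose_gen[OF _ H]) (use inb in \<open>auto intro!: holomorphic_intros\<close>)
    then show ?thesis by (simp add: o_def)
  qed
  have "v x = Re (H x)" if x: "x \<in> ball p e" for x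
  proof (rule ccontr)
    assume "v x \<noteq> Re (H x)"
    then have less: "v x < Re (H x)" using le[OF x] by simp
    \<comment> \<open>The unshifted disc touches the boundary at the origin, over \<open>p\<close>,
      and lies inside over \<open>x\<close>, where the inequality is assumed strict.\<close>
    define g where "g \<zeta> = (\<i> * H (p + of_real e * \<zeta>), p + of_real e * \<zeta>)" for \<zeta>
    define d where "d n = inverse (real (Suc n))" for n
    have d: "0 < d n" "d \<longlonglongrightarrow> 0" for n
      unfolding d_def using LIMSEQ_inverse_real_of_nat by auto
    define f where "f n \<zeta> = (\<i> * (H (p + of_real e * \<zeta>) + of_real (d n)), p + of_real e * \<zeta>)" for n \<zeta>
    have "g 0 \<in> Omega (\<lambda>w. ereal (v w))"
    proof (rule taut_pointwise_limit[OF X, where f = f and g = g and \<omega> = "(x - p) / of_real e"])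
      have px: "p + of_real e * ((x - p) / of_real e) = x" using e by simp
      show "(x - p) / of_real e \<in> ball 0 1"
        using x e by (simp add: norm_divide dist_norm norm_minus_commute)
      show "g ((x - p) / of_real e) \<in> Omega (\<lambda>w. ereal (v w))"
        unfolding g_def px using less by (simp add: Omega_def)
      show "f n \<in> hol_discs (Omega (\<lambda>w. ereal (v w)))" for n
      proof -
        have "v (p + of_real e * \<zeta>) < Re (H (p + of_real e * \<zeta>)) + d n" if "\<zeta> \<in> ball 0 1" for \<zeta>
          using le[OF inb[OF that]] d(1)[of n] by linarith
        then show ?thesis
          unfolding f_def hol_discs_def Omega_def
          by (auto intro!: holomorphic_intros holH)
      qed
      show "(\<lambda>n. f n \<zeta>) \<longlonglongrightarrow> g \<zeta>" for \<zeta>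
      proof -
        have "(\<lambda>n. f n \<zeta>) \<longlonglongrightarrow> (\<i> * (H (p + of_real e * \<zeta>) + of_real 0), p + of_real e * \<zeta>)"
          unfolding f_def by (intro tendsto_intros d(2))
        then show ?thesis by (simp add: g_def)
      qed
    qed simp
    then show False using eq by (simp add: g_def Omega_def)
  qed
  then show "\<forall>\<^sub>F x in nhds p. v x = Re (H x)"
    using eventually_nhds_in_open[of "ball p e" p] e by (auto elim!: eventually_mono)
qed

lemma taut_Omega_imp_not_harmonic:
  fixes v :: "complex \<Rightarrow> real"
  assumes X: "taut (Omega (\<lambda>w. ereal (v w)))"
  shows "\<not> harmonic_on UNIV v"
proof
  assume v: "harmonic_on UNIV v"
  have "\<exists>F. F holomorphic_on ball 0 (real (Suc n)) \<and> (\<forall>x\<in>ball 0 (real (Suc n)). v x = Re (F x))" for n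
    by (rule harmonic_on_UNIV_imp_Re[OF v, of "real (Suc n)" 0]) auto
  then obtain F where F: "\<And>n. F n holomorphic_on ball 0 (real (Suc n))"
    "\<And>n x. x \<in> ball 0 (real (Suc n)) \<Longrightarrow> v x = Re (F n x)"
    by metis
  \<comment> \<open>Subtracting the imaginary part at 0 makes the value at the origin independent of
    \<open>n\<close>; adding 1 places the disc at height 1 above the graph of
    \<open>v\<close>.\<close>
  define f where "f n \<zeta> = (\<i> * (F n (of_nat (Suc n) * \<zeta>) - \<i> * of_real (Im (F n 0)) + 1), of_nat (Suc n) * \<zeta>)" for n \<zeta>
  have inb: "of_nat (Suc n) * \<zeta> \<in> ball 0 (real (Suc n))" if "\<zeta> \<in> ball 0 1" for n and \<zeta> :: complex
    using that by (simp add: norm_mult del: of_nat_Suc)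
  have disc: "f n \<in> hol_discs (Omega (\<lambda>w. ereal (v w)))" for n
  proof -
    have "F n \<circ> (\<lambda>\<zeta>. of_nat (Suc n) * \<zeta>) holomorphic_on ball 0 1"
      by (rule holomorphic_on_compose_gen[OF _ F(1)]) (use inb in \<open>auto intro!: holomorphic_intros simp del: of_nat_Suc\<close>)
    then have "(\<lambda>\<zeta>. F n (of_nat (Suc n) * \<zeta>)) holomorphic_on ball 0 1" by (simp add: o_def)
    then show ?thesis
      unfolding f_def hol_discs_def Omega_def
      using F(2)[OF inb] by (auto intro!: holomorphic_intros simp del: of_nat_Suc)
  qed
  have f0: "f n 0 = (\<i> * of_real (v 0 + 1), 0)" for n
  proof -
    have "F n 0 - \<i> * of_real (Im (F n 0)) = of_real (v 0)"
      using F(2)[of 0 n] by (simp add: complex_eq_iff)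
    then show ?thesis by (simp add: f_def)
  qed
  have "filterlim (\<lambda>n. norm (f n (1/2))) at_top sequentially"
  proof (rule filterlim_at_top_mono)
    show "filterlim (\<lambda>n. real n * (1/2)) at_top sequentially"
      by (rule filterlim_at_top_mult_tendsto_pos[OF tendsto_const _ filterlim_real_sequentially]) simp
    have "real n * (1/2) \<le> norm (f n (1/2))" for n
    proof -
      have "real n * (1/2) \<le> norm (of_nat (Suc n) * (1/2) :: complex)" by (simp only: norm_mult norm_of_nat) simp
      also have "\<dots> \<le> norm (f n (1/2))" unfolding f_def by (rule norm_snd_le)
      finally show ?thesis .
    qed
    then show "\<forall>\<^sub>F n in sequentially. real n * (1/2) \<le> norm (f n (1/2))" by simp
  qed
  then show False by (rule taut_not_unbounded[where f = f, OF X disc f0])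
qed

section \<open>Sufficiency: normality of discs and the limit disc\<close>

theorem taut_Omega_if_subh:
  fixes v :: "complex \<Rightarrow> real"
  assumes cv: "continuous_on UNIV v" and sub: "subh UNIV v" and non: "\<not> harmonic_on UNIV v"
    and op: "open (Omega (\<lambda>w. ereal (v w)))"
  shows "taut (Omega (\<lambda>w. ereal (v w)))"
  unfolding taut_def
proof (intro conjI allI impI op)
  define X where "X = Omega (\<lambda>w. ereal (v w))"
  have X: "p \<in> X \<longleftrightarrow> v (snd p) < Im (fst p)" for p by (auto simp: X_def Omega_def)
  fix f :: "nat \<Rightarrow> complex \<Rightarrow> complex \<times> complex" assume f: "\<forall>n. f n \<in> hol_discs (Omega (\<lambda>w. ereal (v w)))"
  have hz: "(\<lambda>\<zeta>. fst (f n \<zeta>)) holomorphic_on ball 0 1" and hw: "(\<lambda>\<zeta>. snd (f n \<zeta>)) holomorphic_on ball 0 1"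
    and less: "\<And>\<zeta>. \<zeta> \<in> ball 0 1 \<Longrightarrow> v (snd (f n \<zeta>)) < Im (fst (f n \<zeta>))" for n
    using f by (auto simp: hol_discs_def Omega_def image_subset_iff split_beta)
  show "\<exists>\<rho>. strict_mono \<rho> \<and> (converges_in_discs (Omega (\<lambda>w. ereal (v w))) (f \<circ> \<rho>) \<or>
      compactly_divergent (Omega (\<lambda>w. ereal (v w))) (f \<circ> \<rho>))"
    unfolding X_def[symmetric]
  proof (cases "compactly_divergent X f")
    case True
    then show "\<exists>\<rho>. strict_mono \<rho> \<and> (converges_in_discs X (f \<circ> \<rho>) \<or> compactly_divergent X (f \<circ> \<rho>))"
      by (intro exI[of _ id]) (auto simp: strict_mono_def)
  next
    case False
    then obtain K L where K: "compact K" "K \<subseteq> ball 0 1" and L: "compact L" "L \<subseteq> X"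
      and freq: "\<not> (\<forall>\<^sub>F n in sequentially. f n ` K \<inter> L = {})"
      unfolding compactly_divergent_def by blast
    have "infinite {n. f n ` K \<inter> L \<noteq> {}}"
      using freq by (simp add: eventually_cofinite cofinite_eq_sequentially[symmetric])
    \<comment> \<open>A failure of compact divergence yields infinitely many discs that meet
      \<open>L\<close> at parameters in \<open>K\<close>; these parameters supply the base points
      for the local bounds.\<close>
    from infinite_enumerate[OF this]
    obtain \<sigma> :: "nat \<Rightarrow> nat" where \<sigma>: "strict_mono \<sigma>" "\<forall>n. \<sigma> n \<in> {n. f n ` K \<inter> L \<noteq> {}}"
      by blast
    then have "\<forall>n. \<exists>x. x \<in> K \<and> f (\<sigma> n) x \<in> L" by blast
    then obtain x where x: "\<And>n. x n \<in> K" "\<And>n. f (\<sigma> n) (x n) \<in> L" by metis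
    obtain \<xi> \<tau> where \<xi>: "\<xi> \<in> K" and \<tau>: "strict_mono \<tau>" "(x \<circ> \<tau>) \<longlonglongrightarrow> \<xi>"
      using K(1) x(1) unfolding compact_def by metis
    define z where "z n \<zeta> = fst (f (\<sigma> (\<tau> n)) \<zeta>)" for n \<zeta>
    define w where "w n \<zeta> = snd (f (\<sigma> (\<tau> n)) \<zeta>)" for n \<zeta>
    \<comment> \<open>The radius \<open>t\<close> is chosen for \<open>K \<union> K'\<close>,
      because the local bound needs the base point and the point to be estimated in one
      disc.\<close>
    have bdd: "\<exists>M. \<forall>n. \<forall>\<zeta>\<in>K'. cmod (z n \<zeta>) \<le> M \<and> cmod (w n \<zeta>) \<le> M" if K': "compact K'" "K' \<subseteq> ball 0 1" for K'
    proof -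
      have "compact (K \<union> K')" "K \<union> K' \<subseteq> ball 0 1" using K K' by auto
      then obtain t where t: "0 \<le> t" "t < 1" "K \<union> K' \<subseteq> cball 0 t"
      proof -
        have "compact (cmod ` (K \<union> K'))" using \<open>compact (K \<union> K')\<close>
          by (intro compact_continuous_image continuous_intros)
        moreover have "cmod ` (K \<union> K') \<noteq> {}" using \<xi> by auto
        ultimately obtain m where m: "m \<in> cmod ` (K \<union> K')" "\<forall>y\<in>cmod ` (K \<union> K'). y \<le> m"
          using compact_attains_sup by metis
        then obtain y where y: "y \<in> K \<union> K'" "m = cmod y" by (elim imageE)
        show ?thesis
        proof (rule that[of m])
          show "0 \<le> m" using y(2) by simp
          show "m < 1" using y \<open>K \<union> K' \<subseteq> ball 0 1\<close> by auto
          show "K \<union> K' \<subseteq> cball 0 m"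
          proof
            fix \<zeta> assume "\<zeta> \<in> K \<union> K'"
            then have "cmod \<zeta> \<le> m" using m(2) by blast
            then show "\<zeta> \<in> cball 0 m" by simp
          qed
        qed
      qed
      obtain M where M: "\<And>z w x y. \<lbrakk>z holomorphic_on ball 0 1; w holomorphic_on ball 0 1;
          \<And>\<zeta>. \<zeta> \<in> ball 0 1 \<Longrightarrow> v (w \<zeta>) \<le> Im (z \<zeta>); x \<in> cball 0 t; (z x, w x) \<in> L; y \<in> cball 0 t\<rbrakk>
          \<Longrightarrow> cmod (z y) \<le> M \<and> cmod (w y) \<le> M"
        using hol_disc_locally_bounded[OF cv sub non L(1) t(1,2)] by metis
      have "cmod (z n \<zeta>) \<le> M \<and> cmod (w n \<zeta>) \<le> M" if "\<zeta> \<in> K'" for n \<zeta>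
      proof (rule M[where x = "x (\<tau> n)" and z = "z n" and w = "w n" and y = \<zeta>])
        show "(z n (x (\<tau> n)), w n (x (\<tau> n))) \<in> L" using x(2) by (simp add: z_def w_def)
        show "x (\<tau> n) \<in> cball 0 t" "\<zeta> \<in> cball 0 t" using x(1) t(3) that by blast+
      qed (use less hz hw in \<open>auto simp: z_def[abs_def] w_def[abs_def] intro: less_imp_le\<close>)
      then show ?thesis by blast
    qed
    obtain g1 r1 where g1: "g1 holomorphic_on ball 0 1" and r1: "strict_mono r1"
      and lim1: "\<And>K. compact K \<Longrightarrow> K \<subseteq> ball 0 1 \<Longrightarrow> uniform_limit K (z \<circ> r1) g1 sequentially"
    proof (rule Montel[of "ball 0 1" "range z" z])
      show "\<exists>B. \<forall>h\<in>range z. \<forall>\<zeta>\<in>K'. cmod (h \<zeta>) \<le> B" if "compact K'" "K' \<subseteq> ball 0 1" for K'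
        using bdd[OF that] by blast
    qed (auto simp: z_def[abs_def] hz)
    obtain g2 r2 where g2: "g2 holomorphic_on ball 0 1" and r2: "strict_mono r2"
      and lim2: "\<And>K. compact K \<Longrightarrow> K \<subseteq> ball 0 1 \<Longrightarrow> uniform_limit K (w \<circ> r1 \<circ> r2) g2 sequentially"
    proof (rule Montel[of "ball 0 1" "range (w \<circ> r1)" "w \<circ> r1"])
      show "\<exists>B. \<forall>h\<in>range (w \<circ> r1). \<forall>\<zeta>\<in>K'. cmod (h \<zeta>) \<le> B" if "compact K'" "K' \<subseteq> ball 0 1" for K'
        using bdd[OF that] by auto
    qed (auto simp: w_def[abs_def] hw)
    define \<rho> where "\<rho> = \<sigma> \<circ> \<tau> \<circ> r1 \<circ> r2"
    define g where "g \<zeta> = (g1 \<zeta>, g2 \<zeta>)" for \<zeta>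
    have \<rho>: "strict_mono \<rho>" unfolding \<rho>_def by (intro strict_mono_o \<sigma> \<tau> r1 r2)
    have unif: "uniform_limit K' (f \<circ> \<rho>) g sequentially" if K': "compact K'" "K' \<subseteq> ball 0 1" for K'
    proof (rule uniform_limitI)
      fix e :: real assume e: "e > 0"
      have "\<forall>\<^sub>F n in sequentially. \<forall>\<zeta>\<in>K'. dist ((z \<circ> r1) (r2 n) \<zeta>) (g1 \<zeta>) < e / 2"
        using eventually_subseq[OF r2] uniform_limitD[OF lim1[OF K'], of "e/2"] e by fastforce
      moreover have "\<forall>\<^sub>F n in sequentially. \<forall>\<zeta>\<in>K'. dist ((w \<circ> r1 \<circ> r2) n \<zeta>) (g2 \<zeta>) < e / 2"
        using uniform_limitD[OF lim2[OF K'], of "e/2"] e by simp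
      ultimately show "\<forall>\<^sub>F n in sequentially. \<forall>\<zeta>\<in>K'. dist ((f \<circ> \<rho>) n \<zeta>) (g \<zeta>) < e"
      proof eventually_elim
        case (elim n)
        show ?case
        proof
          fix \<zeta> assume \<zeta>: "\<zeta> \<in> K'"
          have "dist ((f \<circ> \<rho>) n \<zeta>) (g \<zeta>) \<le> dist (fst ((f \<circ> \<rho>) n \<zeta>)) (g1 \<zeta>) + dist (snd ((f \<circ> \<rho>) n \<zeta>)) (g2 \<zeta>)"
            unfolding dist_prod_def g_def using sqrt_sum_squares_le_sum[OF zero_le_dist zero_le_dist] by simp
          also have "\<dots> < e" using elim \<zeta> by (fastforce simp: \<rho>_def z_def w_def)
          finally show "dist ((f \<circ> \<rho>) n \<zeta>) (g \<zeta>) < e" .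
        qed
      qed
    qed
    have ptw: "(\<lambda>n. f (\<rho> n) \<zeta>) \<longlonglongrightarrow> g \<zeta>" if "\<zeta> \<in> ball 0 1" for \<zeta>
      using tendsto_uniform_limitI[OF unif[of "{\<zeta>}"], of \<zeta>] that by simp
    have le: "v (g2 \<zeta>) \<le> Im (g1 \<zeta>)" if \<zeta>: "\<zeta> \<in> ball 0 1" for \<zeta>
    proof (rule tendsto_le[OF sequentially_bot])
      show "(\<lambda>n. Im (fst (f (\<rho> n) \<zeta>))) \<longlonglongrightarrow> Im (g1 \<zeta>)"
        using tendsto_Im[OF tendsto_fst[OF ptw[OF \<zeta>]]] by (simp add: g_def)
      have "(\<lambda>n. snd (f (\<rho> n) \<zeta>)) \<longlonglongrightarrow> g2 \<zeta>" using tendsto_snd[OF ptw[OF \<zeta>]] by (simp add: g_def)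
      then show "(\<lambda>n. v (snd (f (\<rho> n) \<zeta>))) \<longlonglongrightarrow> v (g2 \<zeta>)"
        by (rule continuous_on_tendsto_compose[OF cv]) auto
    qed (intro always_eventually allI less_imp_le less[OF \<zeta>])
    \<comment> \<open>The values at the moving parameters \<open>y n\<close> lie in
      \<open>L\<close>. Uniform convergence on \<open>K\<close> shows that they tend to
      \<open>g \<xi>\<close>, so the limit disc has at least one point in \<open>X\<close>.\<close>
    have "g \<xi> \<in> X"
    proof -
      define y where "y n = x (\<tau> (r1 (r2 n)))" for n
      have yK: "y n \<in> K" for n using x(1) by (simp add: y_def)
      have ylim: "y \<longlonglongrightarrow> \<xi>"
        using LIMSEQ_subseq_LIMSEQ[OF \<tau>(2) strict_mono_o[OF r1 r2]] by (simp add: y_def[abs_def] o_def)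
      have "continuous_on (ball 0 1) g"
        unfolding g_def by (intro continuous_intros holomorphic_on_imp_continuous_on g1 g2)
      then have gK: "continuous_on K g" using K(2) continuous_on_subset by blast
      have "(\<lambda>n. g (y n)) \<longlonglongrightarrow> g \<xi>"
        using continuous_on_tendsto_compose[OF gK ylim \<xi>] yK by simp
      moreover have "(\<lambda>n. f (\<rho> n) (y n) - g (y n)) \<longlonglongrightarrow> 0"
      proof (rule tendstoI)
        fix e :: real assume "e > 0"
        with unif[OF K] have "\<forall>\<^sub>F n in sequentially. \<forall>\<zeta>\<in>K. dist ((f \<circ> \<rho>) n \<zeta>) (g \<zeta>) < e"
          by (rule uniform_limitD)
        then show "\<forall>\<^sub>F n in sequentially. dist (f (\<rho> n) (y n) - g (y n)) 0 < e"
          by eventually_elim (use yK in \<open>simp add: dist_norm\<close>)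
      qed
      ultimately have "(\<lambda>n. f (\<rho> n) (y n)) \<longlonglongrightarrow> g \<xi>"
        by (rule Lim_transform)
      moreover have "f (\<rho> n) (y n) \<in> L" for n using x(2) by (simp add: \<rho>_def y_def)
      ultimately have "g \<xi> \<in> L"
        using closed_sequentially[OF compact_imp_closed[OF L(1)], of "\<lambda>n. f (\<rho> n) (y n)"] by auto
      then show ?thesis using L(2) by blast
    qed
    \<comment> \<open>One boundary point of the limit disc would be a contact of
      \<open>v \<circ> g2\<close> with the harmonic function \<open>Im g1\<close>, and would put the
      whole disc, including \<open>g \<xi>\<close>, on the boundary.\<close>
    have strict: "v (g2 \<zeta>) < Im (g1 \<zeta>)" if \<zeta>: "\<zeta> \<in> ball 0 1" for \<zeta>
    proof (rule ccontr)
      assume "\<not> v (g2 \<zeta>) < Im (g1 \<zeta>)"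
      then have eq: "v (g2 \<zeta>) = Re (- \<i> * g1 \<zeta>)" using le[OF \<zeta>] by simp
      have "v (g2 \<xi>) = Re (- \<i> * g1 \<xi>)"
      proof (rule subh_strong_max_principle[OF open_ball connected_ball, where v = "\<lambda>\<zeta>. v (g2 \<zeta>)" and p = \<zeta>
            and H = "\<lambda>\<zeta>. - \<i> * g1 \<zeta>"])
        show "subh (ball 0 1) (\<lambda>\<zeta>. v (g2 \<zeta>))"
          by (rule subh_compose[OF open_UNIV cv sub open_ball g2]) simp
        show "continuous_on (ball 0 1) (\<lambda>\<zeta>. v (g2 \<zeta>))"
          by (rule continuous_on_compose2[OF cv holomorphic_on_imp_continuous_on[OF g2]]) simp
        show "\<xi> \<in> ball 0 1" using \<xi> K(2) by blast
      qed (use le \<zeta> eq in \<open>auto intro!: holomorphic_intros g1\<close>)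
      then show False using \<open>g \<xi> \<in> X\<close> by (simp add: X g_def)
    qed
    have "g \<in> hol_discs X"
      using g1 g2 strict by (auto simp: hol_discs_def X g_def)
    then have "converges_in_discs X (f \<circ> \<rho>)" unfolding converges_in_discs_def using unif by blast
    then show "\<exists>\<rho>. strict_mono \<rho> \<and> (converges_in_discs X (f \<circ> \<rho>) \<or> compactly_divergent X (f \<circ> \<rho>))"
      using \<rho> by blast
  qed
qed

theorem theorem3p4:
  fixes a :: "complex \<Rightarrow> ereal"
  assumes "\<And>w. a w \<noteq> \<infinity>"
    and "usc_on UNIV a"
  shows "taut (Omega a) \<longleftrightarrow>
    (\<forall>w. a w \<noteq> -\<infinity>) \<and>
    subharmonic_on UNIV a \<and>
    \<not> harmonic_on UNIV (\<lambda>w. real_of_ereal (a w)) \<and>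
    continuous_on UNIV a"
proof -
  \<comment> \<open>\<open>real_of_ereal\<close> is 0 at infinite values, so \<open>v\<close>
    represents \<open>a\<close> only in the case where \<open>a\<close> is finite
    everywhere.\<close>
  define v where "v w = real_of_ereal (a w)" for w
  show ?thesis
  proof (cases "\<forall>w. a w \<noteq> -\<infinity>")
    case False
    then show ?thesis using taut_Omega_imp_not_MInfty by blast
  next
    case True
    then have "a w = ereal (v w)" for w
      using assms(1)[of w] by (cases "a w") (auto simp: v_def)
    then have a: "a = (\<lambda>w. ereal (v w))" by (rule ext)
    have v: "(\<lambda>w. real_of_ereal (a w)) = v" by (rule ext) (simp add: v_def)
    have cont: "continuous_on UNIV v" if "continuous_on UNIV a"
      using that unfolding a continuous_on_def by simp
    show ?thesis
    proof
      assume "taut (Omega a)"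
      then have X: "taut (Omega (\<lambda>w. ereal (v w)))" by (simp add: a)
      have cv: "continuous_on UNIV v"
        using taut_Omega_imp_continuous[OF X] assms(2) by (simp add: a)
      moreover have "continuous_on UNIV a"
        using cv unfolding a continuous_on_def by simp
      moreover have "subharmonic_on UNIV a"
        using subh_imp_subharmonic[OF cv taut_Omega_imp_subh[OF X]] by (simp add: a)
      ultimately show "(\<forall>w. a w \<noteq> -\<infinity>) \<and> subharmonic_on UNIV a \<and>
          \<not> harmonic_on UNIV (\<lambda>w. real_of_ereal (a w)) \<and> continuous_on UNIV a"
        using True taut_Omega_imp_not_harmonic[OF X] unfolding v by blast
    next
      assume r: "(\<forall>w. a w \<noteq> -\<infinity>) \<and> subharmonic_on UNIV a \<and>
          \<not> harmonic_on UNIV (\<lambda>w. real_of_ereal (a w)) \<and> continuous_on UNIV a"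
      then have cv: "continuous_on UNIV v" using cont by blast
      moreover have "subh UNIV v" using subharmonic_imp_subh[OF cv] r by (simp add: a)
      moreover have "\<not> harmonic_on UNIV v" using r unfolding v by blast
      ultimately show "taut (Omega a)"
        using taut_Omega_if_subh[of v] open_Omega[OF assms(2)] by (simp add: a)
    qed
  qed
qed

end
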